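(* For every integer $n\geq 2$, every $n$-Kakeya book $K\subset\mathbb{R}^n$ has box dimension $n$, i.e. $\dim_{\mathrm{B}}K=n$.
   Context: $S^{n-1}=\{x\in\mathbb{R}^n : \|x\|=1\}$, where $\|\cdot\|$ is the Euclidean norm. $\Omega$-Kakeya sets: for a set of directions $\Omega\subset S^{n-1}$, a set $K(\Omega)\subset\mathbb{R}^n$ is an $\Omega$-Kakeya set if it is bounded and $K(\Omega)=\bigcup_{\theta\in\Omega} l_\theta$, where for each $\theta\in\Omega$, $l_\theta$ is a line segment of unit length centred at some point $a_\theta\in\mathbb{R}^n$ and pointing in direction $\theta$. Kakeya sets: a set $K\subset\mathbb{R}^n$ is a Kakeya set if there is a set $\Omega\subset S^{n-1}$ with non-empty interior (in $S^{n-1}$) such that $K$ is an $\Omega$-Kakeya set. Pages: a $k$-hyperplane is a $k$-dimensional linear subspace. For a $2$-hyperplane $H^2\subset\mathbb{R}^n$ and $v\in H^2\cap S^{n-1}$, let $H^{n-1}(v)$ be the $(n-1)$-hyperplane orthogonal to $v$. The pages with respect to $H^2$ are $P(H^2)=\{H^{n-1}(v) : v\in H^2\cap S^{n-1}\}$. Kakeya books are defined inductively. A $2$-Kakeya book is a bounded Kakeya set in $\mathbb{R}^2$. For $k\geq 2$, a bounded set $K\subset\mathbb{R}^{k+1}$ is a $(k+1)$-Kakeya book if there exist a $2$-hyperplane $H^2\subset\mathbb{R}^{k+1}$ and a constant $C>0$ such that for every $k$-hyperplane $H^k\in P(H^2)$ there is a vector $a\in\mathbb{R}^{k+1}$ such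 that $K\cap(H^k+a)$ contains a $k$-Kakeya book (the affine hyperplane $H^k+a$ being identified isometrically with $\mathbb{R}^k$) which is contained in the ball $B(0,C)\subset\mathbb{R}^{k+1}$. Box dimension $\dim_{\mathrm{B}}$ is the usual box-counting (Minkowski) dimension of a bounded set; the assertion $\dim_{\mathrm{B}}K=n$ means that the lower and upper box dimensions both equal $n$. *)

theory Defs
  imports "HOL-Analysis.Analysis"
begin

text \<open>
  The definition of Kakeya books moves through Euclidean spaces of different dimensions.
  Here the role of \<open>\<real>\<^sup>k\<close> is played by an arbitrary \<open>k\<close>-dimensional linear subspace \<open>V\<close> of one
  ambient Euclidean space, with the inherited inner product; \<open>\<real>\<^sup>n\<close> itself is the case
  \<open>V = UNIV\<close>. An affine plane \<open>a + H\<close> is identified with \<open>H\<close> by translation. By the lemma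
  \<open>kakeya_book_isometry\<close> below, any other isometric identification gives the same notion.
\<close>

definition hyperplane :: "nat \<Rightarrow> 'a::euclidean_space set \<Rightarrow> bool" where
  "hyperplane k H \<longleftrightarrow> subspace H \<and> dim H = k"

definition unit_sphere :: "'a::euclidean_space set \<Rightarrow> 'a set" where
  "unit_sphere V = sphere 0 1 \<inter> V"

definition unit_segment :: "'a::euclidean_space \<Rightarrow> 'a \<Rightarrow> 'a set" where
  "unit_segment a \<theta> = closed_segment (a - (1/2) *\<^sub>R \<theta>) (a + (1/2) *\<^sub>R \<theta>)"

definition directional_kakeya_set :: "'a::euclidean_space set \<Rightarrow> 'a set \<Rightarrow> 'a set \<Rightarrow> bool" where
  "directional_kakeya_set V \<Omega> K \<longleftrightarrow>
     bounded K \<and> (\<exists>a. (\<forall>\<theta>\<in>\<Omega>. a \<theta> \<in> V) \<and> K = (\<Union>\<theta>\<in>\<Omega>. unit_segment (a \<theta>) \<theta>))"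

definition kakeya_set :: "'a::euclidean_space set \<Rightarrow> 'a set \<Rightarrow> bool" where
  "kakeya_set V K \<longleftrightarrow>
     (\<exists>\<Omega>. \<Omega> \<subseteq> unit_sphere V \<and> top_of_set (unit_sphere V) interior_of \<Omega> \<noteq> {} \<and>
          directional_kakeya_set V \<Omega> K)"

definition pages :: "'a::euclidean_space set \<Rightarrow> 'a set \<Rightarrow> 'a set set" where
  "pages V P = {{x \<in> V. orthogonal v x} | v. v \<in> unit_sphere P}"

inductive kakeya_book :: "nat \<Rightarrow> 'a::euclidean_space set \<Rightarrow> 'a set \<Rightarrow> bool" where
  base: "\<lbrakk>hyperplane 2 V; bounded K; kakeya_set V K\<rbrakk> \<Longrightarrow> kakeya_book 2 V K"
| step: "\<lbrakk>k \<ge> 2; hyperplane (k + 1) V; K \<subseteq> V; bounded K;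
          hyperplane 2 P; P \<subseteq> V; C > 0;
          \<forall>H \<in> pages V P. \<exists>a \<in> V. \<exists>B. kakeya_book k H B \<and>
             (+) a ` B \<subseteq> K \<inter> (+) a ` H \<and> (+) a ` B \<subseteq> cball 0 C\<rbrakk>
         \<Longrightarrow> kakeya_book (k + 1) V K"

text \<open>
  Box dimension via the least number of closed \<open>\<delta>\<close>-balls needed to cover. It is meant for
  nonempty bounded sets: for unbounded sets the covering number is a junk value.
\<close>

definition covering_number :: "'a::metric_space set \<Rightarrow> real \<Rightarrow> nat" where
  "covering_number K \<delta> = (LEAST m. \<exists>A. finite A \<and> card A = m \<and> K \<subseteq> (\<Union>x\<in>A. cball x \<delta>))"

definition lower_box_dim :: "'a::metric_space set \<Rightarrow> ereal" where
  "lower_box_dim K =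
     Liminf (at_right 0) (\<lambda>\<delta>::real. ereal (ln (real (covering_number K \<delta>)) / - ln \<delta>))"

definition upper_box_dim :: "'a::metric_space set \<Rightarrow> ereal" where
  "upper_box_dim K =
     Limsup (at_right 0) (\<lambda>\<delta>::real. ereal (ln (real (covering_number K \<delta>)) / - ln \<delta>))"

definition has_box_dim :: "'a::metric_space set \<Rightarrow> real \<Rightarrow> bool" where
  "has_box_dim K d \<longleftrightarrow> lower_box_dim K = ereal d \<and> upper_box_dim K = ereal d"

lemma unit_segment_affine:
  assumes "linear f"
  shows "(\<lambda>x. f x + b) ` unit_segment a t = unit_segment (f a + b) (f t)"
proof -
  have "(\<lambda>x. f x + b) ` closed_segment p q = closed_segment (f p + b) (f q + b)" for p q
    using closed_segment_translation[of b "f p" "f q"] closed_segment_linear_image[OF assms, of p q]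
    by (simp add: image_image add.commute)
  then show ?thesis
    using assms by (simp add: unit_segment_def linear_add linear_diff linear_scale algebra_simps)
qed

lemma inj_on_linear_isometry:
  fixes f :: "'a::euclidean_space \<Rightarrow> 'b::euclidean_space"
  assumes "subspace V" "linear f" "\<forall>x\<in>V. norm (f x) = norm x"
  shows "inj_on f V"
proof (rule inj_onI)
  fix x y assume "x \<in> V" "y \<in> V" "f x = f y"
  then have "norm (x - y) = norm (f x - f y)"
    using assms by (metis linear_diff subspace_diff)
  then show "x = y" using \<open>f x = f y\<close> by simp
qed

lemma hyperplane_linear_isometry:
  fixes f :: "'a::euclidean_space \<Rightarrow> 'b::euclidean_space"
  assumes "hyperplane k V" "linear f" "\<forall>x\<in>V. norm (f x) = norm x"
  shows "hyperplane k (f ` V)"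
proof -
  have "subspace V" "dim V = k" using assms(1) by (auto simp: hyperplane_def)
  moreover have "inj_on f (span V)"
    using inj_on_linear_isometry assms \<open>subspace V\<close> by (metis span_eq_iff)
  ultimately show ?thesis
    using assms dim_image_eq[of f V] by (simp add: hyperplane_def linear_subspace_image)
qed

lemma unit_sphere_linear_isometry:
  assumes "\<forall>x\<in>V. norm (f x) = norm x"
  shows "f ` unit_sphere V = unit_sphere (f ` V)"
  using assms by (auto simp: unit_sphere_def)

lemma orthogonal_linear_isometry:
  fixes f :: "'a::euclidean_space \<Rightarrow> 'b::euclidean_space"
  assumes "subspace V" "linear f" "\<forall>x\<in>V. norm (f x) = norm x" "x \<in> V" "y \<in> V"
  shows "orthogonal (f x) (f y) \<longleftrightarrow> orthogonal x y"
proof -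
  have "norm (f x + f y) = norm (x + y)"
    using assms by (metis linear_add subspace_add)
  then show ?thesis
    using assms by (simp add: orthogonal_def dot_norm)
qed

lemma kakeya_set_isometry:
  fixes f :: "'a::euclidean_space \<Rightarrow> 'b::euclidean_space"
  assumes "kakeya_set V K" "subspace V" "linear f" "\<forall>x\<in>V. norm (f x) = norm x" "b \<in> f ` V"
  shows "kakeya_set (f ` V) ((\<lambda>x. f x + b) ` K)"
proof -
  obtain \<Omega> a where O: "\<Omega> \<subseteq> unit_sphere V" "top_of_set (unit_sphere V) interior_of \<Omega> \<noteq> {}"
     "bounded K" "\<forall>\<theta>\<in>\<Omega>. a \<theta> \<in> V" "K = (\<Union>\<theta>\<in>\<Omega>. unit_segment (a \<theta>) \<theta>)"
    using assms by (auto simp: kakeya_set_def directional_kakeya_set_def)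
  have inj: "inj_on f V" using inj_on_linear_isometry assms by blast
  have sph: "f ` unit_sphere V = unit_sphere (f ` V)"
    using unit_sphere_linear_isometry assms by blast
  have sub: "unit_sphere V \<subseteq> V" by (simp add: unit_sphere_def)
  have bl: "bounded_linear f" using assms by (simp add: linear_conv_bounded_linear)
  have cS: "compact (unit_sphere V)"
    unfolding unit_sphere_def using assms by (simp add: closed_subspace compact_Int_closed)
  obtain g where g: "homeomorphism (unit_sphere V) (unit_sphere (f ` V)) f g"
    using homeomorphism_compact[OF cS linear_continuous_on[OF bl] sph] inj sub
    by (meson inj_on_subset)
  obtain U x where U: "openin (top_of_set (unit_sphere V)) U" "x \<in> U" "U \<subseteq> \<Omega>"
    using O(2) by (auto simp: interior_of_def)
  have "openin (top_of_set (unit_sphere (f ` V))) (f ` U)"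
    using g U(1) homeomorphism_imp_open_map by blast
  then have "f ` U \<subseteq> top_of_set (unit_sphere (f ` V)) interior_of (f ` \<Omega>)"
    using U(3) by (simp add: interior_of_maximal image_mono)
  then have int: "top_of_set (unit_sphere (f ` V)) interior_of (f ` \<Omega>) \<noteq> {}"
    using U(2) by blast
  have bd: "bounded ((\<lambda>x. f x + b) ` K)"
    using bounded_translation[OF bounded_linear_image[OF O(3) bl], of b]
    by (simp add: image_image add.commute)
  have injO: "inj_on f \<Omega>" using inj O(1) sub by (meson inj_on_subset subset_trans)
  define a' where "a' = (\<lambda>t. f (a (the_inv_into \<Omega> f t)) + b)"
  have a': "a' (f t) = f (a t) + b" if "t \<in> \<Omega>" for t
    using that injO by (simp add: a'_def the_inv_into_f_f)
  have "subspace (f ` V)" using assms by (simp add: linear_subspace_image)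
  then have cen: "\<forall>\<theta>\<in>f ` \<Omega>. a' \<theta> \<in> f ` V"
    using O(4) assms by (auto simp: a' subspace_add)
  have "(\<lambda>x. f x + b) ` K = (\<Union>\<theta>\<in>\<Omega>. unit_segment (f (a \<theta>) + b) (f \<theta>))"
    unfolding O(5) using unit_segment_affine[OF assms(3), of b] by (simp add: image_UN)
  also have "\<dots> = (\<Union>\<theta>\<in>f ` \<Omega>. unit_segment (a' \<theta>) \<theta>)"
    by (simp add: a')
  finally show ?thesis
    using int bd cen image_mono[OF O(1), of f] unfolding kakeya_set_def directional_kakeya_set_def sph
    by blast
qed

lemma kakeya_book_isometry:
  fixes f :: "'a::euclidean_space \<Rightarrow> 'b::euclidean_space"
  assumes "kakeya_book k V K" "linear f" "\<forall>x\<in>V. norm (f x) = norm x" "b \<in> f ` V"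
  shows "kakeya_book k (f ` V) ((\<lambda>x. f x + b) ` K)"
  using assms
proof (induction arbitrary: b rule: kakeya_book.induct)
  case (base V K)
  have "bounded_linear f" using base by (simp add: linear_conv_bounded_linear)
  then have "bounded ((\<lambda>x. f x + b) ` K)"
    using bounded_translation[OF bounded_linear_image[OF base(2)], of f b]
    by (simp add: image_image add.commute)
  then show ?case
    using base by (intro kakeya_book.base kakeya_set_isometry hyperplane_linear_isometry)
      (auto simp: hyperplane_def)
next
  case (step k V K P C)
  have V: "subspace V" using step by (simp add: hyperplane_def)
  then have fV: "subspace (f ` V)" using step by (simp add: linear_subspace_image)
  have bl: "bounded_linear f" using step by (simp add: linear_conv_bounded_linear)
  have nP: "\<forall>x\<in>P. norm (f x) = norm x" using step by blast
  have PV: "P \<subseteq> V" by fact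
  show ?case
  proof (rule kakeya_book.step[where P = "f ` P" and C = "C + norm b"])
    show "bounded ((\<lambda>x. f x + b) ` K)"
      using bounded_translation[OF bounded_linear_image[OF step(4) bl], of b]
      by (simp add: image_image add.commute)
    show "(\<lambda>x. f x + b) ` K \<subseteq> f ` V"
      using step fV by (auto simp: subspace_add)
    show "\<forall>H\<in>pages (f ` V) (f ` P).
       \<exists>a\<in>f ` V. \<exists>B. kakeya_book k H B \<and>
          (+) a ` B \<subseteq> (\<lambda>x. f x + b) ` K \<inter> (+) a ` H \<and> (+) a ` B \<subseteq> cball 0 (C + norm b)"
    proof
      fix H' assume "H' \<in> pages (f ` V) (f ` P)"
      then obtain w where w: "w \<in> unit_sphere (f ` P)" "H' = {x \<in> f ` V. orthogonal w x}"
        by (auto simp: pages_def)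
      then obtain v where v: "v \<in> unit_sphere P" "w = f v"
        using unit_sphere_linear_isometry[OF nP] by blast
      define H where "H = {x \<in> V. orthogonal v x}"
      have vV: "v \<in> V" using v PV by (auto simp: unit_sphere_def)
      have H': "H' = f ` H"
        using w v vV orthogonal_linear_isometry[OF V step.prems(1,2) vV]
        by (auto simp: H_def)
      have "H \<in> pages V P" using v by (auto simp: pages_def H_def)
      then obtain a B where aB: "a \<in> V" "kakeya_book k H B"
         "linear f \<longrightarrow> (\<forall>x\<in>H. norm (f x) = norm x) \<longrightarrow>
            (\<forall>c. c \<in> f ` H \<longrightarrow> kakeya_book k (f ` H) ((\<lambda>x. f x + c) ` B))"
         "(+) a ` B \<subseteq> K \<inter> (+) a ` H" "(+) a ` B \<subseteq> cball 0 C"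
        using bspec[OF step.IH \<open>H \<in> pages V P\<close>] by (elim bexE exE conjE) (assumption | rule that)+
      have HV: "H \<subseteq> V" by (auto simp: H_def)
      have BV: "a + x \<in> V" if "x \<in> B" for x using aB(4) that step by blast
      have "0 \<in> H" using V by (simp add: H_def orthogonal_def subspace_0)
      then have "0 \<in> f ` H" using step.prems(1) by (metis imageI linear_0)
      then have 1: "kakeya_book k H' (f ` B)"
        using aB(3) step.prems HV H' \<open>0 \<in> f ` H\<close> by (auto dest!: spec[of _ 0])
      have eq: "(+) (f a + b) ` (f ` B) = (\<lambda>x. f x + b) ` ((+) a ` B)"
        using step.prems by (simp add: image_image linear_add algebra_simps)
      have 2: "(+) (f a + b) ` (f ` B) \<subseteq> (\<lambda>x. f x + b) ` K"
        unfolding eq using aB(4) by blast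
      have BH: "B \<subseteq> H" using aB(4) by auto
      have 3: "(+) (f a + b) ` (f ` B) \<subseteq> (+) (f a + b) ` H'"
        unfolding H' using BH by blast
      have 4: "(+) (f a + b) ` (f ` B) \<subseteq> cball 0 (C + norm b)"
      proof -
        have "norm (f (a + x) + b) \<le> C + norm b" if "x \<in> B" for x
        proof -
          have "norm (f (a + x)) = norm (a + x)" using step.prems BV that by blast
          moreover have "norm (a + x) \<le> C" using aB(5) that by auto
          ultimately show ?thesis using norm_triangle_ineq[of "f (a + x)" b] by linarith
        qed
        then show ?thesis unfolding eq by auto
      qed
      have "f a + b \<in> f ` V" using fV aB(1) step.prems by (simp add: subspace_add)
      then show "\<exists>a\<in>f ` V. \<exists>B. kakeya_book k H' B \<and>
          (+) a ` B \<subseteq> (\<lambda>x. f x + b) ` K \<inter> (+) a ` H' \<and> (+) a ` B \<subseteq> cball 0 (C + norm b)"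
        using 1 2 3 4 by (metis Int_subset_iff)
    qed
    show "C + norm b > 0" using step by (simp add: add_pos_nonneg)
    show "f ` P \<subseteq> f ` V" using PV by blast
    show "hyperplane 2 (f ` P)" using hyperplane_linear_isometry step nP by blast
    show "hyperplane (k + 1) (f ` V)" using hyperplane_linear_isometry step by blast
  qed (use step in auto)
qed

end

theory Submission
  imports Defs "HOL-Real_Asymp.Real_Asymp"
begin

text \<open>
  The upper bound holds for every bounded set. The lower bound is Cordoba's \<open>L\<^sup>2\<close> argument,
  used once for the planar case and again at every step of the induction on the dimension.

  Suppose that a bounded set \<open>K\<close> in a space of dimension \<open>k + 1\<close> contains, for each slope \<open>s\<close> in
  an interval, a subset \<open>S\<close> of a hyperplane with normal \<open>p + s q\<close>, where \<open>p\<close> and \<open>q\<close> are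
  orthonormal, and that the covering numbers of \<open>S\<close> are at least \<open>\<delta> powr (\<epsilon> - k)\<close> for
  small \<open>\<delta>\<close>. Choose about \<open>1 / \<delta>\<close> slopes at mutual distances at least of order \<open>\<delta>\<close>. The slabs of
  thickness \<open>\<delta>\<close> around two of the hyperplanes have, inside a fixed ball, at most about
  \<open>\<delta> powr (1 - k) / \<bar>s - s'\<bar>\<close> grid cubes of side \<open>\<delta>\<close> in common. Summing over all pairs gives a harmonic
  sum, hence a total overlap of about \<open>\<delta> powr (- k - 1)\<close> times a logarithm, while the slices
  together have at least \<open>\<delta> powr (\<epsilon> - k - 1)\<close> cubes. By the Cauchy--Schwarz inequality the union has at
  least about \<open>\<delta> powr (2 * \<epsilon> - k - 1)\<close> cubes up to a logarithm. So \<open>K\<close> has growth \<open>k + 1\<close>; this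
  is \<open>covering_growth_sheaf\<close>. Slabs around whole hyperplanes may replace the slices
  in the overlap count because the slices have nearly full dimension.

  The definition of a book gives no control over how small \<open>\<delta>\<close> must be for a given page: the
  threshold depends on \<open>s\<close>. The Baire category theorem (\<open>Baire_dense_level\<close>) provides
  one threshold that serves a set of slopes dense in some subinterval, and a dense set is enough to
  choose separated slopes from (\<open>dense_separated_points\<close>).

  For a planar Kakeya set the slices are the unit segments themselves
  (\<open>covering_growth_kakeya_set\<close>), and for a higher book they are the books in its pages
  (\<open>covering_growth_kakeya_book\<close>). Volumes are replaced throughout by numbers of grid cubes
  in a basis that contains \<open>p\<close> and \<open>q\<close>; thus subspaces of every dimension of the one ambient space are
  treated alike.
\<close>

section \<open>Counting lattice points and overlapping families\<close>

lemma card_int_ball_le: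
  fixes c r :: real
  assumes "r \<ge> 0"
  shows "finite {z::int. \<bar>z - c\<bar> \<le> r}" and "real (card {z::int. \<bar>z - c\<bar> \<le> r}) \<le> 2 * r + 1"
proof -
  have eq: "{z::int. \<bar>z - c\<bar> \<le> r} = {\<lceil>c - r\<rceil>..\<lfloor>c + r\<rfloor>}"
    by (auto simp: abs_le_iff ceiling_le_iff le_floor_iff)
  show "finite {z::int. \<bar>z - c\<bar> \<le> r}" unfolding eq by simp
  have "real_of_int (\<lfloor>c + r\<rfloor> - \<lceil>c - r\<rceil> + 1) \<le> 2 * r + 1" by linarith
  moreover have "0 \<le> 2 * r + 1" using assms by simp
  ultimately show "real (card {z::int. \<bar>z - c\<bar> \<le> r}) \<le> 2 * r + 1"
    unfolding eq card_atLeastAtMost_int by (smt (verit) nat_0_le of_int_of_nat_eq nat_eq_iff2 of_nat_0)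
qed

lemma card_int_box_le:
  fixes r :: real
  assumes "finite B" "r \<ge> 0"
  shows "finite (PiE B (\<lambda>_. {z::int. \<bar>real_of_int z\<bar> \<le> r}))"
    and "real (card (PiE B (\<lambda>_. {z::int. \<bar>real_of_int z\<bar> \<le> r}))) \<le> (2 * r + 1) ^ card B"
proof -
  note * = card_int_ball_le[OF assms(2), of 0, simplified]
  show "finite (PiE B (\<lambda>_. {z::int. \<bar>real_of_int z\<bar> \<le> r}))" using assms * by (intro finite_PiE) auto
  show "real (card (PiE B (\<lambda>_. {z::int. \<bar>real_of_int z\<bar> \<le> r}))) \<le> (2 * r + 1) ^ card B"
    using assms * by (auto simp: card_PiE intro!: power_mono)
qed

text \<open>
  The coordinate \<open>q\<close> is confined to an interval and, once it is known, so is \<open>p\<close>; the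
  other coordinates range freely over a box. In the application \<open>\<rho>\<close> is
  about the reciprocal of the angle between two hyperplanes, so the bound is a discrete
  form of the volume of the intersection of two thickened hyperplanes.
\<close>

lemma card_lattice_slab_le:
  fixes Z :: "('b \<Rightarrow> int) set" and r \<rho> R s u w :: real
  assumes B: "finite B" "p \<in> B" "q \<in> B" "p \<noteq> q" and Z: "Z \<subseteq> extensional B"
    and r: "r \<ge> 0" "\<rho> \<ge> 0" "R \<ge> 0"
    and q: "\<And>z. z \<in> Z \<Longrightarrow> \<bar>z q - u\<bar> \<le> \<rho>"
    and p: "\<And>z. z \<in> Z \<Longrightarrow> \<bar>z p + s * z q - w\<bar> \<le> R"
    and o: "\<And>z b. z \<in> Z \<Longrightarrow> b \<in> B \<Longrightarrow> \<bar>real_of_int (z b)\<bar> \<le> r"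
  shows "real (card Z) \<le> (2 * \<rho> + 1) * (2 * R + 1) * (2 * r + 1) ^ (card B - 2)"
proof -
  define B' where "B' = B - {p, q}"
  define Q where "Q = {z::int. \<bar>z - u\<bar> \<le> \<rho>}"
  define P where "P = (\<lambda>j::int. {z::int. \<bar>z - (w - s * j)\<bar> \<le> R})"
  define O' where "O' = PiE B' (\<lambda>_. {z::int. \<bar>real_of_int z\<bar> \<le> r})"
  define \<phi> where "\<phi> = (\<lambda>z::'b \<Rightarrow> int. ((z q, z p), restrict z B'))"
  have B': "finite B'" "card B' = card B - 2" using B by (auto simp: B'_def card_Diff_subset)
  have Q: "finite Q" "real (card Q) \<le> 2 * \<rho> + 1"
    unfolding Q_def by (rule card_int_ball_le; fact)+
  have P: "finite (P j)" "real (card (P j)) \<le> 2 * R + 1" for j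
    unfolding P_def by (rule card_int_ball_le; fact)+
  have O': "finite O'" "real (card O') \<le> (2 * r + 1) ^ (card B - 2)"
    using card_int_box_le[OF B'(1) r(1)] B' by (auto simp: O'_def)
  have "inj_on \<phi> Z"
  proof (rule inj_onI)
    fix y z assume yz: "y \<in> Z" "z \<in> Z" "\<phi> y = \<phi> z"
    then have "y b = z b" if "b \<in> B" for b
      using that by (cases "b \<in> B'") (auto simp: \<phi>_def B'_def dest: fun_cong[of _ _ b] split: if_splits)
    then show "y = z" using Z yz by (meson extensionalityI subsetD)
  qed
  moreover have "\<phi> ` Z \<subseteq> Sigma Q P \<times> O'"
    using q p o by (force simp: \<phi>_def Q_def P_def O'_def B'_def algebra_simps PiE_def)
  ultimately have "card Z \<le> card (Sigma Q P \<times> O')"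
    using Q P O' by (metis card_image card_mono finite_SigmaI)
  also have "\<dots> = card (Sigma Q P) * card O'" by (rule card_cartesian_product)
  also have "card (Sigma Q P) = (\<Sum>j\<in>Q. card (P j))" using Q P by simp
  finally have "real (card Z) \<le> (\<Sum>j\<in>Q. real (card (P j))) * real (card O')"
    by (metis of_nat_le_iff of_nat_mult of_nat_sum)
  also have "\<dots> \<le> (\<Sum>j\<in>Q. 2 * R + 1) * real (card O')"
    using P by (intro mult_right_mono sum_mono) auto
  also have "\<dots> \<le> (2 * \<rho> + 1) * (2 * R + 1) * (2 * r + 1) ^ (card B - 2)"
    using Q O' r by (auto intro!: mult_mono)
  finally show ?thesis .
qed

text \<open>
  If \<open>f x\<close> is the number of sets of the family that contain \<open>x\<close>, then the left-hand side is
  the square of the sum of \<open>f\<close>, and the double sum is the sum of \<open>f\<^sup>2\<close>. Thus a family with few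
  pairwise overlaps has a large union.
\<close>

lemma card_Union_Cauchy_Schwarz:
  assumes "finite I" "\<And>i. i \<in> I \<Longrightarrow> finite (Q i)"
  shows "(\<Sum>i\<in>I. real (card (Q i)))\<^sup>2 \<le>
           real (card (\<Union>i\<in>I. Q i)) * (\<Sum>i\<in>I. \<Sum>j\<in>I. real (card (Q i \<inter> Q j)))"
proof -
  define U where "U = (\<Union>i\<in>I. Q i)"
  have U: "finite U" using assms by (auto simp: U_def)
  define f where "f = (\<lambda>x. \<Sum>i\<in>I. indicator (Q i) x :: real)"
  have card_eq: "real (card A) = (\<Sum>x\<in>U. indicator A x)" if "A \<subseteq> U" for A
    using that U by (simp add: indicator_def sum.If_cases Int_absorb1 Collect_conj_eq)
  have 1: "(\<Sum>i\<in>I. real (card (Q i))) = (\<Sum>x\<in>U. 1 * f x)"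
  proof -
    have "(\<Sum>i\<in>I. real (card (Q i))) = (\<Sum>i\<in>I. \<Sum>x\<in>U. indicator (Q i) x)"
      by (intro sum.cong card_eq) (auto simp: U_def)
    then show ?thesis by (simp add: f_def sum.swap[of _ I U])
  qed
  have 2: "(\<Sum>i\<in>I. \<Sum>j\<in>I. real (card (Q i \<inter> Q j))) = (\<Sum>x\<in>U. (f x)\<^sup>2)"
  proof -
    have "(\<Sum>i\<in>I. \<Sum>j\<in>I. real (card (Q i \<inter> Q j)))
        = (\<Sum>i\<in>I. \<Sum>j\<in>I. \<Sum>x\<in>U. indicator (Q i) x * indicator (Q j) x)"
      by (intro sum.cong refl, subst card_eq) (auto simp: U_def indicator_inter_arith)
    also have "\<dots> = (\<Sum>i\<in>I. \<Sum>x\<in>U. \<Sum>j\<in>I. indicator (Q i) x * indicator (Q j) x)"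
      by (intro sum.cong refl sum.swap)
    also have "\<dots> = (\<Sum>x\<in>U. \<Sum>i\<in>I. \<Sum>j\<in>I. indicator (Q i) x * indicator (Q j) x)"
      by (rule sum.swap)
    finally show ?thesis by (simp add: f_def power2_eq_square sum_product)
  qed
  show ?thesis
    using Cauchy_Schwarz_ineq_sum[of "\<lambda>_. 1" f U] unfolding 1 2 U_def by simp
qed

text \<open>
  The terms with \<open>j \<le> i\<close> and those with \<open>i \<le> j\<close> each form an initial part of the harmonic
  series. This is the only source of a logarithmic loss in the argument.
\<close>

lemma sum_inverse_distance_le:
  assumes "i < M"
  shows "(\<Sum>j<M. 1 / (1 + \<bar>real i - real j\<bar>)) \<le> 2 * (1 + ln (real M))"
proof -
  have h: "harm n = (\<Sum>d<n. 1 / (1 + real d))" for n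
    by (simp add: harm_altdef inverse_eq_divide)
  let ?f = "\<lambda>j. 1 / (1 + \<bar>real i - real j\<bar>)"
  have "(\<Sum>j<M. ?f j) \<le> (\<Sum>j<Suc i. ?f j) + (\<Sum>j\<in>{i..<M}. ?f j)"
  proof -
    have "{..<M} = {..<i} \<union> {i..<M}" using assms by auto
    then have "(\<Sum>j<M. ?f j) = (\<Sum>j<i. ?f j) + (\<Sum>j\<in>{i..<M}. ?f j)"
      by (simp add: sum.union_disjoint ivl_disj_int)
    then show ?thesis by simp
  qed
  also have "(\<Sum>j<Suc i. ?f j) = (\<Sum>d<Suc i. 1 / (1 + real d))"
    by (rule sum.reindex_bij_witness[of _ "\<lambda>d. i - d" "\<lambda>j. i - j"]) (auto simp: of_nat_diff)
  also have "(\<Sum>j\<in>{i..<M}. ?f j) = (\<Sum>d<M - i. 1 / (1 + real d))"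
    by (rule sum.reindex_bij_witness[of _ "\<lambda>d. i + d" "\<lambda>j. j - i"]) (auto simp: of_nat_diff)
  also have "(\<Sum>d<Suc i. 1 / (1 + real d)) + (\<Sum>d<M - i. 1 / (1 + real d)) \<le> harm M + harm M"
    unfolding h[symmetric] using assms by (intro add_mono harm_mono) auto
  also have "harm M \<le> 1 + ln (real M)"
    using euler_mascheroni_sequence_decreasing[of 1 M] assms by (simp add: harm_expand)
  finally show ?thesis by simp
qed

section \<open>Covering numbers and grid cells\<close>

lemma covering_number_le:
  assumes "finite A" "K \<subseteq> (\<Union>x\<in>A. cball x \<delta>)"
  shows "covering_number K \<delta> \<le> card A"
  unfolding covering_number_def by (rule Least_le) (use assms in blast)

lemma covering_number_attained:
  fixes K :: "'a::euclidean_space set"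
  assumes "bounded K" "\<delta> > 0"
  obtains A where "finite A" "card A = covering_number K \<delta>" "K \<subseteq> (\<Union>x\<in>A. cball x \<delta>)"
proof -
  have "compact (closure K)" using assms(1) by simp
  then obtain k where "finite k" "closure K \<subseteq> (\<Union>x\<in>k. ball x \<delta>)"
    using assms(2) by (auto simp: compact_eq_totally_bounded)
  then have "K \<subseteq> (\<Union>x\<in>k. ball x \<delta>)" using closure_subset by blast
  also have "\<dots> \<subseteq> (\<Union>x\<in>k. cball x \<delta>)" by (intro UN_mono ball_subset_cball) simp
  finally have "\<exists>A. finite A \<and> card A = card k \<and> K \<subseteq> (\<Union>x\<in>A. cball x \<delta>)"
    using \<open>finite k\<close> by blast
  then have "\<exists>A. finite A \<and> card A = covering_number K \<delta> \<and> K \<subseteq> (\<Union>x\<in>A. cball x \<delta>)"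
    unfolding covering_number_def by (rule LeastI)
  then show ?thesis using that by blast
qed

lemma covering_number_translation_le:
  fixes K :: "'a::euclidean_space set"
  assumes "bounded K" "\<delta> > 0"
  shows "covering_number K \<delta> \<le> covering_number ((+) a ` K) \<delta>"
proof -
  have "bounded ((+) a ` K)" using assms bounded_translation by blast
  then obtain A where A: "finite A" "card A = covering_number ((+) a ` K) \<delta>"
      "(+) a ` K \<subseteq> (\<Union>x\<in>A. cball x \<delta>)"
    using covering_number_attained assms by blast
  have "K \<subseteq> (\<Union>x\<in>(\<lambda>x. x - a) ` A. cball x \<delta>)"
  proof
    fix y assume "y \<in> K"
    then obtain x where "x \<in> A" "dist x (a + y) \<le> \<delta>" using A(3) by fastforce
    then show "y \<in> (\<Union>x\<in>(\<lambda>x. x - a) ` A. cball x \<delta>)"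
      by (auto simp: dist_norm algebra_simps)
  qed
  then have "covering_number K \<delta> \<le> card ((\<lambda>x. x - a) ` A)"
    using A(1) covering_number_le by blast
  also have "\<dots> \<le> card A" using A(1) by (rule card_image_le)
  finally show ?thesis using A(2) by simp
qed

text \<open>
  The index of the grid cube of side \<open>\<delta>\<close> that contains \<open>x\<close>, with respect to the axes \<open>B\<close>.
  It is undefined off \<open>B\<close>, so that two points in the same cube have equal indices.
\<close>

definition cell :: "'a::euclidean_space set \<Rightarrow> real \<Rightarrow> 'a \<Rightarrow> 'a \<Rightarrow> int" where
  "cell B \<delta> x = (\<lambda>b\<in>B. \<lfloor>(x \<bullet> b) / \<delta>\<rfloor>)"

lemma cell_coordinate_bound:
  assumes "b \<in> B" "norm b = 1" "\<delta> > 0" "norm x \<le> C"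
  shows "\<bar>real_of_int (cell B \<delta> x b)\<bar> \<le> C / \<delta> + 1"
proof -
  have "\<bar>x \<bullet> b\<bar> \<le> C" using Cauchy_Schwarz_ineq2[of x b] assms by simp
  then have "\<bar>(x \<bullet> b) / \<delta>\<bar> \<le> C / \<delta>" using assms by (simp add: divide_right_mono)
  moreover have "cell B \<delta> x b = \<lfloor>(x \<bullet> b) / \<delta>\<rfloor>" using assms(1) by (simp add: cell_def)
  ultimately show ?thesis by linarith
qed

lemma finite_cells:
  assumes "finite B" "\<And>b. b \<in> B \<Longrightarrow> norm b = 1" "\<delta> > 0" "\<And>x. x \<in> K \<Longrightarrow> norm x \<le> C" "C \<ge> 0"
  shows "finite (cell B \<delta> ` K)" "real (card (cell B \<delta> ` K)) \<le> (2 * (C / \<delta> + 1) + 1) ^ card B"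
proof -
  have r: "C / \<delta> + 1 \<ge> 0" using assms by simp
  have "cell B \<delta> ` K \<subseteq> PiE B (\<lambda>_. {z::int. \<bar>real_of_int z\<bar> \<le> C / \<delta> + 1})"
    using cell_coordinate_bound assms by (fastforce simp: PiE_def cell_def)
  note * = this card_int_box_le[OF assms(1) r]
  show "finite (cell B \<delta> ` K)" using * finite_subset by blast
  show "real (card (cell B \<delta> ` K)) \<le> (2 * (C / \<delta> + 1) + 1) ^ card B"
    using * card_mono by (smt (verit) of_nat_mono)
qed

text \<open>
  Along each axis, a ball of radius \<open>\<delta>\<close> reaches at most the cell of its centre and the two
  neighbouring ones.
\<close>

lemma card_cells_le_covering_number:
  assumes "finite B" "\<And>b. b \<in> B \<Longrightarrow> norm b = 1" "\<delta> > 0" "bounded K"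
  shows "card (cell B \<delta> ` K) \<le> 3 ^ card B * covering_number K \<delta>"
proof -
  obtain A where A: "finite A" "card A = covering_number K \<delta>" "K \<subseteq> (\<Union>x\<in>A. cball x \<delta>)"
    using covering_number_attained assms by blast
  define N where "N = (\<lambda>x. PiE B (\<lambda>b. {\<lfloor>(x \<bullet> b) / \<delta>\<rfloor> - 1 .. \<lfloor>(x \<bullet> b) / \<delta>\<rfloor> + 1}))"
  have N: "finite (N x)" "card (N x) = 3 ^ card B" for x
    using assms(1) by (auto simp: N_def card_PiE intro!: finite_PiE)
  have "cell B \<delta> ` K \<subseteq> (\<Union>x\<in>A. N x)"
  proof (rule image_subsetI)
    fix y assume "y \<in> K"
    then obtain x where x: "x \<in> A" "norm (x - y) \<le> \<delta>" using A(3) by (fastforce simp: dist_norm)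
    have "cell B \<delta> y b \<in> {\<lfloor>(x \<bullet> b) / \<delta>\<rfloor> - 1 .. \<lfloor>(x \<bullet> b) / \<delta>\<rfloor> + 1}" if b: "b \<in> B" for b
    proof -
      have "\<bar>(x - y) \<bullet> b\<bar> \<le> \<delta>"
        using Cauchy_Schwarz_ineq2[of "x - y" b] x assms(2)[OF b] by simp
      then have "\<bar>(x - y) \<bullet> b / \<delta>\<bar> \<le> 1" using assms(3) by (simp add: divide_le_eq_1_pos)
      then have "\<bar>(x \<bullet> b) / \<delta> - (y \<bullet> b) / \<delta>\<bar> \<le> 1"
        by (simp add: inner_diff_left diff_divide_distrib)
      then show ?thesis using b by (simp add: cell_def) linarith
    qed
    then have "cell B \<delta> y \<in> N x" by (auto simp: N_def PiE_def cell_def)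
    then show "cell B \<delta> y \<in> (\<Union>x\<in>A. N x)" using x by blast
  qed
  then have "card (cell B \<delta> ` K) \<le> card (\<Union>x\<in>A. N x)"
    using A(1) N(1) by (intro card_mono) auto
  also have "\<dots> \<le> (\<Sum>x\<in>A. card (N x))" using A(1) by (rule card_UN_le)
  also have "\<dots> = 3 ^ card B * covering_number K \<delta>" using A(2) N(2) by simp
  finally show ?thesis .
qed

text \<open>
  Choosing one point of \<open>K\<close> in each cube met by \<open>K\<close> gives the centres of a cover, because a
  cube has diameter at most \<open>card B * \<delta>\<close>.
\<close>

lemma covering_number_le_card_cells:
  assumes B: "finite B" "pairwise orthogonal B" "\<And>b. b \<in> B \<Longrightarrow> norm b = 1"
    and K: "K \<subseteq> span B" "finite (cell B \<delta> ` K)" and d: "\<delta> > 0"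
  shows "covering_number K (real (card B) * \<delta>) \<le> card (cell B \<delta> ` K)"
proof -
  define g where "g = inv_into K (cell B \<delta>)"
  have "K \<subseteq> (\<Union>x\<in>g ` cell B \<delta> ` K. cball x (real (card B) * \<delta>))"
  proof
    fix y assume y: "y \<in> K"
    define x where "x = g (cell B \<delta> y)"
    have x: "x \<in> K" "cell B \<delta> x = cell B \<delta> y"
      using y by (auto simp: x_def g_def inv_into_into f_inv_into_f)
    have c: "\<bar>(x - y) \<bullet> b\<bar> \<le> \<delta>" if "b \<in> B" for b
    proof -
      have "\<lfloor>(x \<bullet> b) / \<delta>\<rfloor> = \<lfloor>(y \<bullet> b) / \<delta>\<rfloor>"
        using fun_cong[OF x(2), of b] that by (simp add: cell_def)
      then have "\<bar>(x \<bullet> b) / \<delta> - (y \<bullet> b) / \<delta>\<bar> \<le> 1" by linarith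
      then have "\<bar>((x - y) \<bullet> b) / \<delta>\<bar> \<le> 1" by (simp add: inner_diff_left diff_divide_distrib)
      then show ?thesis using d by (simp add: divide_le_eq_1_pos)
    qed
    have "x - y \<in> span B" using x y K by (meson span_diff subsetD)
    then have "x - y = (\<Sum>b\<in>B. ((x - y) \<bullet> b) *\<^sub>R b)"
      using orthonormal_basis_expand[OF B(2,3)] B(1) by simp
    then have "norm (x - y) \<le> (\<Sum>b\<in>B. norm (((x - y) \<bullet> b) *\<^sub>R b))" by (metis norm_sum)
    also have "\<dots> \<le> (\<Sum>b\<in>B. \<delta>)" using c B(3) by (intro sum_mono) simp
    finally have "y \<in> cball x (real (card B) * \<delta>)" by (simp add: dist_norm)
    then show "y \<in> (\<Union>x\<in>g ` cell B \<delta> ` K. cball x (real (card B) * \<delta>))"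
      using y x_def by blast
  qed
  then have "covering_number K (real (card B) * \<delta>) \<le> card (g ` cell B \<delta> ` K)"
    using K(2) by (intro covering_number_le) auto
  also have "\<dots> \<le> card (cell B \<delta> ` K)" using K(2) by (rule card_image_le)
  finally show ?thesis .
qed

section \<open>Lower bounds on the growth of covering numbers\<close>

text \<open>
  For bounded sets this is the statement that the lower box dimension is at least \<open>d\<close>, in a
  form with an explicit threshold for \<open>\<delta>\<close>, which is what the category argument below
  quantifies over.
\<close>

definition covering_growth :: "real \<Rightarrow> 'a::euclidean_space set \<Rightarrow> bool" where
  "covering_growth d K \<longleftrightarrow>
     (\<forall>\<epsilon>>0. \<forall>\<^sub>F \<delta> in at_right 0. \<delta> powr (\<epsilon> - d) \<le> real (covering_number K \<delta>))"

lemma covering_growth_translation: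
  fixes K :: "'a::euclidean_space set"
  assumes "covering_growth d K" "bounded K"
  shows "covering_growth d ((+) a ` K)"
  unfolding covering_growth_def
proof (intro allI impI)
  fix \<epsilon> :: real assume "\<epsilon> > 0"
  then have "\<forall>\<^sub>F \<delta> in at_right 0. \<delta> powr (\<epsilon> - d) \<le> real (covering_number K \<delta>)"
    using assms(1) by (simp add: covering_growth_def)
  then show "\<forall>\<^sub>F \<delta> in at_right 0. \<delta> powr (\<epsilon> - d) \<le> real (covering_number ((+) a ` K) \<delta>)"
    using eventually_at_right_less[of "0::real"]
  proof eventually_elim
    case (elim \<delta>)
    then show ?case using covering_number_translation_le[OF assms(2), of \<delta> a] by linarith
  qed
qed

text \<open>
  Project to the line in direction \<open>\<theta>\<close>: the projection is an interval of length one, and it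
  meets at least \<open>1 / \<delta> - 1\<close> intervals of the grid.
\<close>

lemma covering_growth_unit_segment:
  assumes "norm \<theta> = 1"
  shows "covering_growth 1 (unit_segment a \<theta>)"
  unfolding covering_growth_def
proof (intro allI impI)
  fix \<epsilon> :: real assume \<epsilon>: "\<epsilon> > 0"
  define K where "K = unit_segment a \<theta>"
  have bK: "bounded K" unfolding K_def unit_segment_def by (rule bounded_closed_segment)
  have *: "1 / \<delta> - 1 \<le> 3 * real (covering_number K \<delta>)" if \<delta>: "\<delta> > 0" for \<delta>
  proof -
    define J where "J = {\<lceil>(a \<bullet> \<theta> - 1/2) / \<delta>\<rceil>..\<lfloor>(a \<bullet> \<theta> + 1/2) / \<delta>\<rfloor>}"
    have J: "(\<lambda>j. \<lambda>b\<in>{\<theta>}. j) ` J \<subseteq> cell {\<theta>} \<delta> ` K"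
    proof (rule image_subsetI)
      fix j assume "j \<in> J"
      then have "(a \<bullet> \<theta> - 1/2) / \<delta> \<le> j" "j \<le> (a \<bullet> \<theta> + 1/2) / \<delta>"
        by (auto simp: J_def ceiling_le_iff le_floor_iff)
      then have j: "a \<bullet> \<theta> - 1/2 \<le> j * \<delta>" "j * \<delta> \<le> a \<bullet> \<theta> + 1/2"
        using \<delta> by (auto simp: field_simps)
      \<comment> \<open>The parameter of the point of the segment whose projection is \<open>j * \<delta>\<close>.\<close>
      define u where "u = j * \<delta> - a \<bullet> \<theta> + 1/2"
      define x where "x = (1 - u) *\<^sub>R (a - (1/2) *\<^sub>R \<theta>) + u *\<^sub>R (a + (1/2) *\<^sub>R \<theta>)"
      have "x \<in> K"
        unfolding K_def unit_segment_def closed_segment_def mem_Collect_eq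
        using j by (intro exI[of _ u]) (auto simp: u_def x_def)
      have "\<theta> \<bullet> \<theta> = 1" using assms by (simp add: norm_eq_1)
      then have "x \<bullet> \<theta> = j * \<delta>" by (simp add: x_def u_def inner_add_left inner_diff_left algebra_simps)
      then have "cell {\<theta>} \<delta> x = (\<lambda>b\<in>{\<theta>}. j)" using \<delta> by (auto simp: cell_def)
      then show "(\<lambda>b\<in>{\<theta>}. j) \<in> cell {\<theta>} \<delta> ` K" using \<open>x \<in> K\<close> by (metis imageI)
    qed
    obtain C where C: "\<And>x. x \<in> K \<Longrightarrow> norm x \<le> C" "C > 0"
      using bK by (meson bounded_pos)
    have "inj_on (\<lambda>j. \<lambda>b\<in>{\<theta>}. j) J" by (rule inj_onI) (metis restrict_apply' singletonI)
    then have "card J = card ((\<lambda>j. \<lambda>b\<in>{\<theta>}. j) ` J)" by (simp add: card_image)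
    also have "\<dots> \<le> card (cell {\<theta>} \<delta> ` K)"
      using J finite_cells(1)[of "{\<theta>}" \<delta> K C] C assms \<delta> by (intro card_mono) auto
    also have "\<dots> \<le> 3 * covering_number K \<delta>"
      using card_cells_le_covering_number[of "{\<theta>}" \<delta> K] assms \<delta> bK by simp
    finally have "real (card J) \<le> 3 * real (covering_number K \<delta>)" by linarith
    moreover have "(a \<bullet> \<theta> + 1/2) / \<delta> - (a \<bullet> \<theta> - 1/2) / \<delta> = 1 / \<delta>"
      by (simp flip: diff_divide_distrib)
    then have "1 / \<delta> - 1 \<le> real (card J)" unfolding J_def by simp linarith
    ultimately show ?thesis by linarith
  qed
  have "\<forall>\<^sub>F \<delta> in at_right (0::real). \<delta> powr (\<epsilon> - 1) \<le> (1 / \<delta> - 1) / 3"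
    using \<epsilon> by real_asymp
  then show "\<forall>\<^sub>F \<delta> in at_right 0. \<delta> powr (\<epsilon> - 1) \<le> real (covering_number (unit_segment a \<theta>) \<delta>)"
    using eventually_at_right_less[of "0::real"]
  proof eventually_elim
    case (elim \<delta>)
    then show ?case using *[of \<delta>] by (simp add: K_def)
  qed
qed

section \<open>Choosing well-spread slopes\<close>

text \<open>
  The level sets of \<open>P\<close> cover an interval, so by the Baire category theorem they cannot all
  be nowhere dense. This is what turns a threshold that depends on the slope
  \<open>s\<close> in an uncontrolled way into a uniform one.
\<close>

lemma Baire_dense_level:
  fixes P :: "nat \<Rightarrow> real \<Rightarrow> bool"
  assumes "l < r" "\<And>s. s \<in> {l<..<r} \<Longrightarrow> \<exists>m. P m s"
  obtains m a b where "a < b" "{a<..<b} \<subseteq> closure {s \<in> {l<..<r}. P m s}"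
proof -
  define A where "A = (\<lambda>m. {s \<in> {l<..<r}. P m s})"
  have "\<exists>m. interior (closure (A m)) \<noteq> {}"
  proof (rule ccontr)
    assume "\<not> ?thesis"
    then have e: "interior (closure (A m)) = {}" for m by blast
    define G where "G = range (\<lambda>m. - closure (A m))"
    have "UNIV \<subseteq> closure (\<Inter>G)"
    proof (rule Baire)
      show "countable G" by (simp add: G_def)
      fix T assume "T \<in> G"
      then show "openin (top_of_set UNIV) T \<and> UNIV \<subseteq> closure T"
        using e by (auto simp: G_def open_Compl closure_complement)
    qed simp
    moreover have "s \<notin> \<Inter>G" if s: "s \<in> {l<..<r}" for s
    proof -
      obtain m where "s \<in> A m" using assms(2)[OF s] s by (auto simp: A_def)
      then have "s \<in> closure (A m)" using closure_subset by blast
      then show ?thesis by (auto simp: G_def)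
    qed
    then have "{l<..<r} \<inter> \<Inter>G = {}" by blast
    then have "{l<..<r} \<inter> closure (\<Inter>G) = {}"
      by (simp add: open_Int_closure_eq_empty)
    moreover have "(l + r) / 2 \<in> {l<..<r}" using assms(1) by (simp add: field_simps)
    ultimately show False by blast
  qed
  then obtain m x where "x \<in> interior (closure (A m))" by blast
  then obtain e where "e > 0" "ball x e \<subseteq> closure (A m)" by (meson mem_interior)
  then show ?thesis using that[of "x - e" "x + e" m] by (simp add: A_def ball_eq_greaterThanLessThan)
qed

text \<open>
  Cut the interval into \<open>2 * M\<close> equal pieces and choose a point of the dense set in every
  other one. The pieces left out guarantee the separation of neighbours.
\<close>

lemma dense_separated_points:
  fixes A :: "real set"
  assumes "a < b" "{a<..<b} \<subseteq> closure A" "M > 0"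
  shows "\<exists>s. (\<forall>i<M. s i \<in> A \<inter> {a<..<b}) \<and>
    (\<forall>i<M. \<forall>j<M. (b - a) / 2 * \<bar>real i - real j\<bar> / M \<le> \<bar>s i - s j\<bar>)"
proof -
  define h where "h = (b - a) / (2 * real M)"
  have h: "h > 0" "2 * real M * h = b - a" using assms by (auto simp: h_def)
  have "\<exists>x. x \<in> A \<inter> {a + 2 * real i * h <..< a + (2 * real i + 1) * h}" if "i < M" for i
  proof -
    have "2 * real i + 1 \<le> 2 * real M" using that by linarith
    then have "(2 * real i + 1) * h \<le> b - a" using h mult_right_mono[of _ "2 * real M" h] by fastforce
    moreover have "0 \<le> 2 * real i * h" using h by simp
    ultimately have sub: "{a + 2 * real i * h <..< a + (2 * real i + 1) * h} \<subseteq> {a<..<b}"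
      unfolding subset_eq Ball_def greaterThanLessThan_iff
      by (intro allI impI conjI; elim conjE; linarith)
    define m where "m = a + (2 * real i + 1 / 2) * h"
    have m: "m \<in> {a + 2 * real i * h <..< a + (2 * real i + 1) * h}"
      using h by (auto simp: m_def algebra_simps)
    then have "{a + 2 * real i * h <..< a + (2 * real i + 1) * h} \<inter> closure A \<noteq> {}"
      using sub assms(2) by blast
    then show ?thesis
      using open_Int_closure_eq_empty[OF open_greaterThanLessThan,
          of "a + 2 * real i * h" "a + (2 * real i + 1) * h" A]
      by blast
  qed
  then obtain s where s: "\<And>i. i < M \<Longrightarrow> s i \<in> A \<inter> {a + 2 * real i * h <..< a + (2 * real i + 1) * h}" by metis
  have inc: "(real j - real i) * h \<le> s j - s i" if "i < j" "j < M" for i j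
  proof -
    have "s i < a + (2 * real i + 1) * h" "a + 2 * real j * h < s j" using s[of i] s[of j] that by auto
    then have "(2 * real j - 2 * real i - 1) * h \<le> s j - s i" by (simp add: algebra_simps)
    moreover have "(real j - real i) * h \<le> (2 * real j - 2 * real i - 1) * h"
      using that h by (intro mult_right_mono) auto
    ultimately show ?thesis by linarith
  qed
  have "(b - a) / 2 * \<bar>real i - real j\<bar> / M \<le> \<bar>s i - s j\<bar>" if "i < M" "j < M" for i j
  proof -
    have "(b - a) / 2 * \<bar>real i - real j\<bar> / M = \<bar>real i - real j\<bar> * h"
      by (simp add: h_def)
    then show ?thesis
      using inc[of i j] inc[of j i] that by (cases i j rule: linorder_cases) auto
  qed
  moreover have "s i \<in> A \<inter> {a<..<b}" if "i < M" for i
  proof -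
    have "2 * real i + 1 \<le> 2 * real M" using that by linarith
    then have "(2 * real i + 1) * h \<le> b - a" using h mult_right_mono[of _ "2 * real M" h] by fastforce
    moreover have "0 \<le> 2 * real i * h" using h by simp
    moreover have "s i \<in> A" "a + 2 * real i * h < s i" "s i < a + (2 * real i + 1) * h"
      using s[OF that] by auto
    ultimately have "a < s i" "s i < b" by linarith+
    then show ?thesis using \<open>s i \<in> A\<close> by simp
  qed
  ultimately show ?thesis by blast
qed

section \<open>Sheaves of hyperplanes\<close>

text \<open>
  On a cube of side \<open>\<delta>\<close> met by the hyperplane of slope \<open>s\<close>, the integer \<open>z p + s * z q\<close> is known
  up to a bounded error. If the cube also meets the hyperplane of slope \<open>s'\<close>, subtraction
  bounds \<open>(s - s') * z q\<close>, which leaves about \<open>1 / \<bar>s - s'\<bar>\<close> values for \<open>z q\<close>. The parameter \<open>d\<close>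
  stands for the distance between the indices of the two slopes in a family with gaps of
  order \<open>\<delta>\<close>. For \<open>d = 0\<close> the slopes may coincide, and then only boundedness of the set limits \<open>z q\<close>.
\<close>

lemma card_common_cells_le:
  fixes p q :: "'a::euclidean_space" and C L \<kappa> d \<delta> s s' c c' :: real
  assumes B: "finite B" "\<And>b. b \<in> B \<Longrightarrow> norm b = 1" "p \<in> B" "q \<in> B" "p \<noteq> q"
    and C: "\<And>x. x \<in> S \<Longrightarrow> norm x \<le> C" "C \<ge> 0"
    and S: "\<And>x. x \<in> S \<Longrightarrow> x \<bullet> p + s * (x \<bullet> q) = c" "\<bar>s\<bar> \<le> L"
    and S': "\<And>x. x \<in> S' \<Longrightarrow> x \<bullet> p + s' * (x \<bullet> q) = c'" "\<bar>s'\<bar> \<le> L"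
    and \<delta>: "0 < \<delta>" "\<delta> < 1"
    and sep: "0 < \<kappa>" "\<kappa> * d * \<delta> \<le> \<bar>s - s'\<bar>" "0 \<le> d" "d = 0 \<or> 1 \<le> d" "d \<le> 1 / \<delta>"
  defines "A \<equiv> (8 * (1 + L) / \<kappa> + 2 * C + 5) * (2 * L + 3) * (2 * C + 3) ^ (card B - 2)"
  shows "real (card (cell B \<delta> ` S \<inter> cell B \<delta> ` S')) \<le> A * (1 / \<delta>) ^ (card B - 1) * (1 / (1 + d))"
proof -
  define Z where "Z = cell B \<delta> ` S \<inter> cell B \<delta> ` S'"
  define r where "r = C / \<delta> + 1"
  have L: "L \<ge> 0" using S(2) by linarith
  have r: "r \<ge> 0" "2 * r + 1 \<le> (2 * C + 3) / \<delta>"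
    using C \<delta> by (auto simp: r_def field_simps)
  have slab: "\<bar>real_of_int (cell B \<delta> x p) + t * real_of_int (cell B \<delta> x q) - g / \<delta>\<bar> \<le> 1 + L"
    if "x \<bullet> p + t * (x \<bullet> q) = g" "\<bar>t\<bar> \<le> L" for x t g
  proof -
    define u where "u = (x \<bullet> p) / \<delta> - \<lfloor>(x \<bullet> p) / \<delta>\<rfloor>"
    define v where "v = (x \<bullet> q) / \<delta> - \<lfloor>(x \<bullet> q) / \<delta>\<rfloor>"
    have uv: "\<bar>u\<bar> \<le> 1" "\<bar>v\<bar> \<le> 1" unfolding u_def v_def by linarith+
    have "\<bar>t * v\<bar> \<le> L * 1" unfolding abs_mult using that uv by (intro mult_mono) auto
    moreover have "real_of_int (cell B \<delta> x p) + t * real_of_int (cell B \<delta> x q) - g / \<delta> = - u - t * v"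
      using B that(1)[symmetric] by (simp add: cell_def u_def v_def algebra_simps add_divide_distrib)
    ultimately show ?thesis using uv by linarith
  qed
  have Zs: "\<bar>z p + s * z q - c / \<delta>\<bar> \<le> 1 + L" "\<bar>z p + s' * z q - c' / \<delta>\<bar> \<le> 1 + L"
    and Zr: "\<And>b. b \<in> B \<Longrightarrow> \<bar>real_of_int (z b)\<bar> \<le> r" if z: "z \<in> Z" for z
  proof -
    obtain x x' where x: "x \<in> S" "x' \<in> S'" "z = cell B \<delta> x" "z = cell B \<delta> x'"
      using z by (auto simp: Z_def)
    show "\<bar>z p + s * z q - c / \<delta>\<bar> \<le> 1 + L" "\<bar>z p + s' * z q - c' / \<delta>\<bar> \<le> 1 + L"
      using slab[of x s c] slab[of x' s' c'] x S S' by auto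
    show "\<bar>real_of_int (z b)\<bar> \<le> r" if "b \<in> B" for b
      using cell_coordinate_bound[of b B \<delta> x C] x C B \<delta> that by (simp add: r_def)
  qed
  obtain u \<rho> where \<rho>: "\<rho> \<ge> 0" "\<And>z. z \<in> Z \<Longrightarrow> \<bar>real_of_int (z q) - u\<bar> \<le> \<rho>"
    "2 * \<rho> + 1 \<le> (8 * (1 + L) / \<kappa> + 2 * C + 5) * (1 / \<delta>) * (1 / (1 + d))"
  proof (cases "d = 0")
    case True
    have "2 * r + 1 \<le> (8 * (1 + L) / \<kappa> + 2 * C + 5) / \<delta>"
      using r(2) \<delta> sep(1) L by (smt (verit) divide_nonneg_pos divide_right_mono mult_nonneg_nonneg)
    then show ?thesis using that[of r 0] r Zr B True by simp
  next
    case False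
    define \<sigma> where "\<sigma> = s - s'"
    have d: "d \<ge> 1" using False sep by simp
    have \<sigma>: "\<kappa> * d * \<delta> \<le> \<bar>\<sigma>\<bar>" "\<bar>\<sigma>\<bar> > 0"
      using sep d \<delta> by (auto simp: \<sigma>_def) (smt (verit) mult_pos_pos)
    define \<rho> where "\<rho> = 2 * (1 + L) / \<bar>\<sigma>\<bar>"
    have "\<bar>real_of_int (z q) - (c - c') / \<delta> / \<sigma>\<bar> \<le> \<rho>" if "z \<in> Z" for z
    proof -
      have "\<sigma> * (z q) - (c - c') / \<delta> = (z p + s * z q - c / \<delta>) - (z p + s' * z q - c' / \<delta>)"
        by (simp add: \<sigma>_def algebra_simps diff_divide_distrib)
      moreover have "\<bar>x - y\<bar> \<le> 2 * (1 + L)" if "\<bar>x\<bar> \<le> 1 + L" "\<bar>y\<bar> \<le> 1 + L" for x y :: real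
        using that by (auto simp: abs_le_iff)
      ultimately have "\<bar>\<sigma> * (z q) - (c - c') / \<delta>\<bar> \<le> 2 * (1 + L)" using Zs[OF that] by metis
      moreover have "\<sigma> * y - g = \<sigma> * (y - g / \<sigma>)" for y g
        using \<sigma>(2) by (simp add: right_diff_distrib)
      ultimately have "\<bar>\<sigma>\<bar> * \<bar>z q - (c - c') / \<delta> / \<sigma>\<bar> \<le> 2 * (1 + L)"
        by (metis abs_mult)
      then show ?thesis using \<sigma>(2) unfolding \<rho>_def by (simp only: pos_le_divide_eq mult.commute)
    qed
    moreover have "\<rho> \<ge> 0" using L by (simp add: \<rho>_def)
    moreover have "2 * \<rho> + 1 \<le> (8 * (1 + L) / \<kappa> + 2 * C + 5) * (1 / \<delta>) * (1 / (1 + d))"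
    proof -
      have inv: "1 / (d * \<delta>) \<le> 2 * (1 / \<delta>) * (1 / (1 + d))"
      proof -
        have "1 / d \<le> 2 * (1 / (1 + d))" using d by (simp add: field_simps)
        then have "1 / d * (1 / \<delta>) \<le> 2 * (1 / (1 + d)) * (1 / \<delta>)"
          using \<delta> by (intro mult_right_mono) auto
        then show ?thesis by (simp add: mult.commute)
      qed
      have "\<rho> \<le> 2 * (1 + L) / (\<kappa> * d * \<delta>)"
        unfolding \<rho>_def using \<sigma> L sep d \<delta> by (intro divide_left_mono) auto
      also have "\<dots> = (2 * (1 + L) / \<kappa>) * (1 / (d * \<delta>))" by simp
      also have "\<dots> \<le> (2 * (1 + L) / \<kappa>) * (2 * (1 / \<delta>) * (1 / (1 + d)))"
        using inv L sep by (intro mult_left_mono) auto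
      finally have "2 * \<rho> \<le> 2 * ((2 * (1 + L) / \<kappa>) * (2 * (1 / \<delta>) * (1 / (1 + d))))" by linarith
      also have "\<dots> = (4 * (2 * (1 + L)) / \<kappa>) * ((1 / \<delta>) * (1 / (1 + d)))" by simp
      also have "4 * (2 * (1 + L)) = 8 * (1 + L)" by simp
      finally have "2 * \<rho> \<le> (8 * (1 + L) / \<kappa>) * ((1 / \<delta>) * (1 / (1 + d)))" .
      moreover have "1 \<le> 1 / (d * \<delta>)" using sep(5) d \<delta> by (simp add: field_simps)
      then have "1 \<le> 2 * ((1 / \<delta>) * (1 / (1 + d)))" using inv by linarith
      moreover have "2 * ((1 / \<delta>) * (1 / (1 + d))) \<le> (2 * C + 5) * ((1 / \<delta>) * (1 / (1 + d)))"
        using C d \<delta> by (intro mult_right_mono) auto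
      ultimately show ?thesis unfolding mult.assoc by (simp only: distrib_right add.assoc)
    qed
    ultimately show ?thesis using that by blast
  qed
  have "real (card Z) \<le> (2 * \<rho> + 1) * (2 * (1 + L) + 1) * (2 * r + 1) ^ (card B - 2)"
  proof (rule card_lattice_slab_le[OF B(1,3-5)])
    show "Z \<subseteq> extensional B" by (auto simp: Z_def cell_def)
  qed (use r \<rho> Zs Zr L in auto)
  also have "\<dots> \<le> ((8 * (1 + L) / \<kappa> + 2 * C + 5) * (1 / \<delta>) * (1 / (1 + d))) * (2 * L + 3) *
      ((2 * C + 3) / \<delta>) ^ (card B - 2)"
    using \<rho> r L C sep \<delta> by (intro mult_mono power_mono) auto
  also have "\<dots> = A * ((1 / \<delta>) * (1 / \<delta>) ^ (card B - 2)) * (1 / (1 + d))"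
    by (simp add: A_def power_divide)
  also have "(1 / \<delta>) * (1 / \<delta>) ^ (card B - 2) = (1 / \<delta>) ^ (card B - 1)"
  proof -
    have "card B \<ge> 2" using B card_mono[of B "{p, q}"] by simp
    then have "card B - 1 = Suc (card B - 2)" by simp
    then show ?thesis by simp
  qed
  finally show ?thesis by (simp add: Z_def)
qed

text \<open>
  The estimate at one scale. Each of the \<open>M\<close> slices occupies at least \<open>\<eta>\<close> cubes, the overlaps
  of the slices are controlled by \<open>card_common_cells_le\<close> and add up to a harmonic sum, and
  \<open>card_Union_Cauchy_Schwarz\<close> bounds from below the number of cubes met by their union.
\<close>

lemma covering_number_sheaf_bound:
  fixes p q :: "'a::euclidean_space" and S :: "nat \<Rightarrow> 'a set"
  assumes B: "finite B" "pairwise orthogonal B" "\<And>b. b \<in> B \<Longrightarrow> norm b = 1" "p \<in> B" "q \<in> B" "p \<noteq> q"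
    and C: "\<And>x. x \<in> K \<Longrightarrow> norm x \<le> C" "C \<ge> 0"
    and S: "\<And>i. i < M \<Longrightarrow> S i \<subseteq> K \<inter> span B"
           "\<And>i x. i < M \<Longrightarrow> x \<in> S i \<Longrightarrow> x \<bullet> p + s i * (x \<bullet> q) = c i"
           "\<And>i. i < M \<Longrightarrow> \<bar>s i\<bar> \<le> L"
           "\<And>i. i < M \<Longrightarrow> \<eta> \<le> real (covering_number (S i) (real (card B) * \<delta>))"
    and M: "M > 0" "real M \<le> 1 / \<delta>"
    and sep: "0 < \<kappa>" "\<And>i j. i < M \<Longrightarrow> j < M \<Longrightarrow> \<kappa> * \<bar>real i - real j\<bar> / M \<le> \<bar>s i - s j\<bar>"
    and \<delta>: "0 < \<delta>" "\<delta> < 1" and \<eta>: "\<eta> \<ge> 0"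
  defines "A \<equiv> (8 * (1 + L) / \<kappa> + 2 * C + 5) * (2 * L + 3) * (2 * C + 3) ^ (card B - 2)"
  shows "real M * \<eta>\<^sup>2 \<le>
    2 * A * 3 ^ card B * (1 / \<delta>) ^ (card B - 1) * (1 + ln (real M)) * real (covering_number K \<delta>)"
proof -
  define Q where "Q = (\<lambda>i. cell B \<delta> ` S i)"
  define T where "T = (1 / \<delta>) ^ (card B - 1)"
  have T: "T > 0" using \<delta> by (simp add: T_def)
  have L: "L \<ge> 0" using S(3)[OF M(1)] by linarith
  have A: "A \<ge> 0" using L C sep by (simp add: A_def)
  have fK: "finite (cell B \<delta> ` K)" using finite_cells(1)[OF B(1,3) \<delta>(1)] C by blast
  have QK: "Q i \<subseteq> cell B \<delta> ` K" if "i < M" for i using S(1)[OF that] by (auto simp: Q_def)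
  have fQ: "finite (Q i)" if "i < M" for i using QK[OF that] fK by (rule finite_subset)
  have bK: "bounded K" using C(1) by (meson boundedI)
  have pair: "real (card (Q i \<inter> Q j)) \<le> A * T * (1 / (1 + \<bar>real i - real j\<bar>))"
    if ij: "i < M" "j < M" for i j
    unfolding Q_def A_def T_def
  proof (rule card_common_cells_le[OF B(1,3-6), where s = "s i" and s' = "s j"])
    show "\<kappa> * \<bar>real i - real j\<bar> * \<delta> \<le> \<bar>s i - s j\<bar>"
    proof -
      have "\<delta> \<le> 1 / real M" using M \<delta> by (simp add: field_simps)
      then have "\<kappa> * \<bar>real i - real j\<bar> * \<delta> \<le> \<kappa> * \<bar>real i - real j\<bar> * (1 / real M)"
        using sep(1) by (intro mult_left_mono) auto
      then show ?thesis using sep(2)[OF ij] by simp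
    qed
    have "i \<noteq> j \<Longrightarrow> 1 \<le> \<bar>real i - real j\<bar>" by linarith
    then show "\<bar>real i - real j\<bar> = 0 \<or> 1 \<le> \<bar>real i - real j\<bar>" by (cases "i = j") auto
    show "\<bar>real i - real j\<bar> \<le> 1 / \<delta>" using ij M(2) by linarith
    show "norm x \<le> C" if "x \<in> S i" for x using that S(1)[OF ij(1)] C(1) by blast
  qed (use S C ij \<delta> sep in auto)
  have "(\<Sum>i<M. \<eta>) \<le> (\<Sum>i<M. real (card (Q i)))"
  proof (rule sum_mono)
    fix i assume "i \<in> {..<M}"
    then have i: "i < M" by simp
    have "covering_number (S i) (real (card B) * \<delta>) \<le> card (Q i)"
      unfolding Q_def using covering_number_le_card_cells[OF B(1-3)] S(1)[OF i] fQ[OF i] \<delta>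
      by (auto simp: Q_def)
    then show "\<eta> \<le> real (card (Q i))" using S(4)[OF i] by linarith
  qed
  then have "real M * \<eta> \<le> (\<Sum>i<M. real (card (Q i)))" by simp
  then have "(real M * \<eta>)\<^sup>2 \<le> (\<Sum>i<M. real (card (Q i)))\<^sup>2"
    using \<eta> by (intro power_mono) auto
  also have "\<dots> \<le> real (card (\<Union>i<M. Q i)) * (\<Sum>i<M. \<Sum>j<M. real (card (Q i \<inter> Q j)))"
    using fQ by (intro card_Union_Cauchy_Schwarz) auto
  also have "\<dots> \<le> (3 ^ card B * real (covering_number K \<delta>)) * (real M * (A * T * (2 * (1 + ln (real M)))))"
  proof (rule mult_mono)
    have "card (\<Union>i<M. Q i) \<le> card (cell B \<delta> ` K)"
      using fK QK by (intro card_mono) auto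
    also have "\<dots> \<le> 3 ^ card B * covering_number K \<delta>"
      by (rule card_cells_le_covering_number[OF B(1,3) \<delta>(1) bK])
    finally show "real (card (\<Union>i<M. Q i)) \<le> 3 ^ card B * real (covering_number K \<delta>)"
      using of_nat_mono by fastforce
    have "(\<Sum>i<M. \<Sum>j<M. real (card (Q i \<inter> Q j)))
        \<le> (\<Sum>i<M. \<Sum>j<M. A * T * (1 / (1 + \<bar>real i - real j\<bar>)))"
      using pair by (intro sum_mono) auto
    also have "\<dots> = (\<Sum>i<M. A * T * (\<Sum>j<M. 1 / (1 + \<bar>real i - real j\<bar>)))"
      by (simp add: sum_distrib_left)
    also have "\<dots> \<le> (\<Sum>i<M. A * T * (2 * (1 + ln (real M))))"
      using A T sum_inverse_distance_le by (intro sum_mono mult_left_mono) auto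
    finally show "(\<Sum>i<M. \<Sum>j<M. real (card (Q i \<inter> Q j))) \<le> real M * (A * T * (2 * (1 + ln (real M))))"
      by simp
  qed (auto intro!: sum_nonneg)
  finally have "real M * (real M * \<eta>\<^sup>2) \<le>
      real M * (2 * A * 3 ^ card B * T * (1 + ln (real M)) * real (covering_number K \<delta>))"
    by (simp only: power2_eq_square mult_ac)
  then show ?thesis using M(1) unfolding T_def by (simp add: mult_le_cancel_left_pos)
qed

text \<open>
  Adjoin to \<open>p\<close> and \<open>q\<close> an orthonormal basis of the part of \<open>V\<close> orthogonal to both.
\<close>

lemma orthonormal_basis_extending_pair:
  fixes V :: "'a::euclidean_space set"
  assumes V: "subspace V" and pq: "p \<in> V" "q \<in> V" "norm p = 1" "norm q = 1" "p \<bullet> q = 0"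
  obtains B where "finite B" "pairwise orthogonal B" "\<And>b. b \<in> B \<Longrightarrow> norm b = 1"
    "p \<in> B" "q \<in> B" "p \<noteq> q" "span B = V" "card B = dim V"
proof -
  define W where "W = {y \<in> V. y \<bullet> p = 0 \<and> y \<bullet> q = 0}"
  have "subspace W"
    using V by (auto simp: W_def subspace_def inner_add_left)
  then obtain B' where B': "B' \<subseteq> W" "pairwise orthogonal B'" "\<And>x. x \<in> B' \<Longrightarrow> norm x = 1"
    "span B' = W"
    by (rule orthonormal_basis_subspace) blast
  define B where "B = insert p (insert q B')"
  have orth: "pairwise orthogonal B"
    using B' pq by (auto simp: B_def pairwise_insert W_def orthogonal_def inner_commute)
  have nrm: "norm b = 1" if "b \<in> B" for b using that B' pq by (auto simp: B_def)
  have "0 \<notin> B" using nrm norm_zero by force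
  then have ind: "independent B" using orth pairwise_orthogonal_independent by blast
  have "p \<noteq> q" using pq by (auto simp: norm_eq_1)
  have "V \<subseteq> span B"
  proof
    fix x assume x: "x \<in> V"
    define w where "w = x - (x \<bullet> p) *\<^sub>R p - (x \<bullet> q) *\<^sub>R q"
    have "w \<in> V" unfolding w_def using V x pq by (intro subspace_diff subspace_scale)
    moreover have "w \<bullet> p = 0" "w \<bullet> q = 0"
      using pq by (auto simp: w_def inner_diff_left norm_eq_1 inner_add_right inner_diff_right inner_commute)
    ultimately have "w \<in> span B'" using B' by (simp add: W_def)
    then have "w \<in> span B" using span_mono[of B' B] by (auto simp: B_def)
    moreover have "p \<in> span B" "q \<in> span B" by (auto simp: B_def span_base)
    ultimately have "w + (x \<bullet> p) *\<^sub>R p + (x \<bullet> q) *\<^sub>R q \<in> span B"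
      by (intro span_add span_scale)
    then show "x \<in> span B" by (simp add: w_def)
  qed
  moreover have "B \<subseteq> V" using B' pq by (auto simp: B_def W_def)
  then have "span B \<subseteq> V" using V by (rule span_minimal)
  ultimately have "span B = V" by blast
  moreover have "finite B" "card B = dim V"
    using indep_card_eq_dim_span[OF ind] \<open>span B = V\<close> by auto
  moreover have "p \<in> B" "q \<in> B" by (simp_all add: B_def)
  ultimately show ?thesis using that[of B] orth nrm \<open>p \<noteq> q\<close> by blast
qed

text \<open>
  The inductive step of the whole argument: slices of growth \<open>k\<close> in hyperplanes whose normals
  \<open>p + s * q\<close> sweep out an arc force growth \<open>k + 1\<close>. The choice of \<open>1 / \<delta>\<close> slopes at distance
  about \<open>\<delta>\<close> makes \<open>covering_number_sheaf_bound\<close> lose only a logarithm and the square of the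
  factor \<open>\<delta> powr e\<close> lost in each slice. The normals are not normalised, so that the overlap of
  two slabs is found by subtracting two linear equations, without trigonometry.
\<close>

proposition covering_growth_sheaf:
  fixes V K :: "'a::euclidean_space set"
  assumes V: "subspace V" "dim V = k + 1"
    and pq: "p \<in> V" "q \<in> V" "norm p = 1" "norm q = 1" "p \<bullet> q = 0"
    and K: "bounded K" and lr: "l < r"
    and S: "\<And>s. s \<in> {l<..<r} \<Longrightarrow>
      \<exists>S c. S \<subseteq> K \<inter> V \<and> covering_growth (real k) S \<and> (\<forall>x\<in>S. x \<bullet> p + s * (x \<bullet> q) = c)"
  shows "covering_growth (real (k + 1)) K"
  unfolding covering_growth_def
proof (intro allI impI)
  fix \<epsilon> :: real assume \<epsilon>: "\<epsilon> > 0"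
  \<comment> \<open>Two of the three parts pay for the slices (the bound is quadratic in them), the third absorbs the logarithm.\<close>
  define e where "e = \<epsilon> / 3"
  have e: "e > 0" using \<epsilon> by (simp add: e_def)
  obtain B where B: "finite B" "pairwise orthogonal B" "\<And>b. b \<in> B \<Longrightarrow> norm b = 1"
    "p \<in> B" "q \<in> B" "p \<noteq> q" "span B = V" "card B = dim V"
    using orthonormal_basis_extending_pair[OF V(1) pq] by metis
  define n where "n = real (card B)"
  have n: "n = real k + 1" "n > 0" using B(8) V(2) by (auto simp: n_def)
  \<comment> \<open>\<open>P m s\<close>: the slice of slope \<open>s\<close> satisfies its lower bound at all scales below \<open>1 / Suc m\<close>.\<close>
  define P where "P = (\<lambda>m s. \<exists>S c. S \<subseteq> K \<inter> V \<and> (\<forall>x\<in>S. x \<bullet> p + s * (x \<bullet> q) = c) \<and>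
     (\<forall>\<delta>. 0 < \<delta> \<and> \<delta> < 1 / real (Suc m) \<longrightarrow> \<delta> powr (e - real k) \<le> real (covering_number S \<delta>)))"
  have "\<exists>m. P m s" if s: "s \<in> {l<..<r}" for s
  proof -
    obtain S c where Sc: "S \<subseteq> K \<inter> V" "covering_growth (real k) S" "\<forall>x\<in>S. x \<bullet> p + s * (x \<bullet> q) = c"
      using S[OF s] by blast
    then obtain b where b: "b > 0" "\<And>\<delta>. 0 < \<delta> \<Longrightarrow> \<delta> < b \<Longrightarrow> \<delta> powr (e - real k) \<le> real (covering_number S \<delta>)"
      using e unfolding covering_growth_def eventually_at_right_field by metis
    obtain m where "1 / real (Suc m) < b" using b(1) nat_approx_posE by blast
    then have "P m s" unfolding P_def using Sc b by (intro exI[of _ S] exI[of _ c]) auto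
    then show ?thesis ..
  qed
  then obtain m a b where ab: "a < b" "{a<..<b} \<subseteq> closure {s \<in> {l<..<r}. P m s}"
    by (rule Baire_dense_level[OF lr])
  obtain C where C: "\<And>x. x \<in> K \<Longrightarrow> norm x \<le> C" "C > 0" using K by (meson bounded_pos)
  define L where "L = max \<bar>a\<bar> \<bar>b\<bar>"
  define \<kappa> where "\<kappa> = (b - a) / 2"
  define A where "A = (8 * (1 + L) / \<kappa> + 2 * C + 5) * (2 * L + 3) * (2 * C + 3) ^ (card B - 2)"
  have \<kappa>: "\<kappa> > 0" using ab by (simp add: \<kappa>_def)
  have L: "L \<ge> 0" by (simp add: L_def)
  have A: "A > 0" unfolding A_def using \<kappa> L C by (intro mult_pos_pos add_nonneg_pos zero_less_power) auto
  define D where "D = 4 * A * 3 ^ card B"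
  have D: "D > 0" using A by (simp add: D_def)
  \<comment> \<open>The bound is applied to slices at scale \<open>n * \<delta>\<close>, since a cube of side \<open>\<delta>\<close> has diameter up to that.\<close>
  have est: "(n * \<delta>) powr (2 * (e - real k)) \<le>
      D * \<delta> * (1 / \<delta>) ^ k * (1 + ln (1 / \<delta>)) * real (covering_number K \<delta>)"
    if \<delta>: "0 < \<delta>" "\<delta> < 1 / 2" "n * \<delta> < 1 / real (Suc m)" for \<delta>
  proof -
    define M where "M = nat \<lfloor>1 / \<delta>\<rfloor>"
    have "2 < 1 / \<delta>" using \<delta> by (simp add: field_simps)
    then have M: "M > 0" "real M \<le> 1 / \<delta>" "1 / \<delta> \<le> 2 * real M" unfolding M_def by linarith+
    obtain s where s: "\<And>i. i < M \<Longrightarrow> s i \<in> {s \<in> {l<..<r}. P m s} \<inter> {a<..<b}"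
      "\<And>i j. i < M \<Longrightarrow> j < M \<Longrightarrow> (b - a) / 2 * \<bar>real i - real j\<bar> / M \<le> \<bar>s i - s j\<bar>"
      using dense_separated_points[OF ab M(1)] by blast
    have "\<exists>S c. i < M \<longrightarrow> S \<subseteq> K \<inter> V \<and> (\<forall>x\<in>S. x \<bullet> p + s i * (x \<bullet> q) = c) \<and>
       (n * \<delta>) powr (e - real k) \<le> real (covering_number S (n * \<delta>))" for i
    proof (cases "i < M")
      case True
      then have "P m (s i)" using s(1) by blast
      moreover have "0 < n * \<delta>" using \<delta> n by simp
      ultimately show ?thesis using \<delta>(3) unfolding P_def by blast
    qed simp
    then obtain S c where Sc: "\<And>i. i < M \<Longrightarrow> S i \<subseteq> K \<inter> V"
       "\<And>i x. i < M \<Longrightarrow> x \<in> S i \<Longrightarrow> x \<bullet> p + s i * (x \<bullet> q) = c i"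
       "\<And>i. i < M \<Longrightarrow> (n * \<delta>) powr (e - real k) \<le> real (covering_number (S i) (n * \<delta>))"
      by metis
    have sL: "\<bar>s i\<bar> \<le> L" if "i < M" for i using s(1)[OF that] by (auto simp: L_def)
    have "real M * ((n * \<delta>) powr (e - real k))\<^sup>2 \<le>
      2 * A * 3 ^ card B * (1 / \<delta>) ^ (card B - 1) * (1 + ln (real M)) * real (covering_number K \<delta>)"
      unfolding A_def
      by (rule covering_number_sheaf_bound[OF B(1-6), where S = S and s = s and c = c])
        (use C Sc sL M \<kappa> \<delta> s(2) in \<open>auto simp: B(7) n_def \<kappa>_def\<close>)
    moreover have "card B - 1 = k" using B(8) V(2) by simp
    moreover have "((n * \<delta>) powr (e - real k))\<^sup>2 = (n * \<delta>) powr (2 * (e - real k))"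
      by (simp add: power2_eq_square flip: powr_add)
    ultimately have "real M * (n * \<delta>) powr (2 * (e - real k)) \<le>
      (D / 2 * (1 / \<delta>) ^ k * real (covering_number K \<delta>)) * (1 + ln (real M))"
      by (simp add: D_def mult_ac)
    also have "\<dots> \<le> (D / 2 * (1 / \<delta>) ^ k * real (covering_number K \<delta>)) * (1 + ln (1 / \<delta>))"
      using M D \<delta> by (intro mult_left_mono add_left_mono) (auto simp flip: ln_div)
    finally have 1: "real M * (n * \<delta>) powr (2 * (e - real k)) \<le>
      (D / 2 * (1 / \<delta>) ^ k * real (covering_number K \<delta>)) * (1 + ln (1 / \<delta>))" .
    have "1 \<le> 2 * real M * \<delta>" using M(3) \<delta> by (simp add: field_simps)
    then have "(n * \<delta>) powr (2 * (e - real k)) \<le> 2 * real M * \<delta> * (n * \<delta>) powr (2 * (e - real k))"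
      using mult_right_mono[of 1 _ "(n * \<delta>) powr (2 * (e - real k))"] by simp
    also have "\<dots> = 2 * \<delta> * (real M * (n * \<delta>) powr (2 * (e - real k)))" by simp
    also have "\<dots> \<le> 2 * \<delta> * ((D / 2 * (1 / \<delta>) ^ k * real (covering_number K \<delta>)) * (1 + ln (1 / \<delta>)))"
      using 1 \<delta> by (intro mult_left_mono) auto
    finally show ?thesis by (simp add: mult_ac)
  qed
  define c where "c = n powr (2 * (e - real k)) / D"
  have c: "c > 0" using n D by (simp add: c_def)
  have "((\<lambda>\<delta>. \<delta> powr e * (1 + ln (1 / \<delta>))) \<longlongrightarrow> 0) (at_right (0::real))"
    using e by real_asymp
  then have "\<forall>\<^sub>F \<delta> in at_right (0::real). \<delta> powr e * (1 + ln (1 / \<delta>)) < c"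
    using c by (simp add: order_tendsto_iff)
  moreover have "\<forall>\<^sub>F \<delta> in at_right (0::real). \<delta> < min (1 / 2) (1 / real (Suc m) / n)"
    using n by (intro eventually_at_rightI[where b = "min (1 / 2) (1 / real (Suc m) / n)"]) auto
  ultimately show "\<forall>\<^sub>F \<delta> in at_right 0. \<delta> powr (\<epsilon> - real (k + 1)) \<le> real (covering_number K \<delta>)"
    using eventually_at_right_less[of "0::real"]
  proof eventually_elim
    case (elim \<delta>)
    have \<delta>: "0 < \<delta>" "\<delta> < 1 / 2" using elim by auto
    have "n * \<delta> < 1 / real (Suc m)" using elim n by (simp add: pos_less_divide_eq mult_ac)
    note * = est[OF \<delta> this]
    define E where "E = 1 + ln (1 / \<delta>)"
    have E: "E > 0" unfolding E_def using \<delta> by (intro add_pos_nonneg ln_ge_zero) auto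
    define N where "N = real (covering_number K \<delta>)"
    have "(1 / \<delta>) ^ k = \<delta> powr (- real k)"
      using \<delta> by (simp add: powr_minus powr_realpow power_one_over inverse_eq_divide)
    then have pw: "\<delta> * (1 / \<delta>) ^ k = \<delta> powr (1 - real k)"
      using \<delta> by (simp add: powr_diff powr_minus field_simps)
    have "D * c * \<delta> powr (2 * (e - real k)) = (n * \<delta>) powr (2 * (e - real k))"
      using D n \<delta> by (simp add: c_def powr_mult)
    also have "\<dots> \<le> D * \<delta> * (1 / \<delta>) ^ k * E * N" using * by (simp only: E_def N_def)
    also have "\<dots> = D * E * N * (\<delta> * (1 / \<delta>) ^ k)" by (simp only: mult_ac)
    finally have "D * c * \<delta> powr (2 * (e - real k)) \<le> D * (E * N * \<delta> powr (1 - real k))"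
      by (simp only: pw mult.assoc)
    then have "c * \<delta> powr (2 * (e - real k)) \<le> E * N * \<delta> powr (1 - real k)"
      using D by (simp add: mult.assoc)
    moreover have "\<delta> powr e * E * \<delta> powr (2 * (e - real k)) \<le> c * \<delta> powr (2 * (e - real k))"
      using elim(1) by (intro mult_right_mono) (auto simp: E_def)
    moreover have "\<delta> powr e * E * \<delta> powr (2 * (e - real k)) = E * \<delta> powr (\<epsilon> - real (k + 1)) * \<delta> powr (1 - real k)"
    proof -
      have "\<delta> powr e * \<delta> powr (2 * (e - real k)) = \<delta> powr (\<epsilon> - real (k + 1)) * \<delta> powr (1 - real k)"
        by (simp add: e_def algebra_simps flip: powr_add)
      then show ?thesis by (simp add: mult_ac)
    qed
    ultimately have "E * \<delta> powr (\<epsilon> - real (k + 1)) * \<delta> powr (1 - real k) \<le> E * N * \<delta> powr (1 - real k)"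
      by linarith
    then show ?case using E \<delta> by (simp add: N_def)
  qed
qed

section \<open>Kakeya books\<close>

lemma unit_vector_in_subspace:
  fixes V :: "'a::euclidean_space set"
  assumes "subspace V" "dim V > 0"
  obtains x where "x \<in> V" "norm x = 1"
proof -
  have "\<not> V \<subseteq> {0}" using assms(2) by (simp flip: dim_eq_0)
  then obtain y where y: "y \<in> V" "y \<noteq> 0" by blast
  show ?thesis
    using y assms(1) by (intro that[of "y /\<^sub>R norm y"]) (auto simp: subspace_scale)
qed

lemma unit_vector_orthogonal_in_subspace:
  fixes V :: "'a::euclidean_space set"
  assumes V: "subspace V" "dim V > 1" and x: "x \<in> V" "norm x = 1"
  obtains y where "y \<in> V" "norm y = 1" "x \<bullet> y = 0"
proof -
  define W where "W = {y \<in> V. \<forall>z\<in>span {x}. orthogonal z y}"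
  have "dim W + dim (span {x}) = dim V"
    unfolding W_def using V x by (intro dim_subspace_orthogonal_to_vectors span_minimal) auto
  moreover have "dim (span {x}) \<le> 1" using dim_le_card'[of "{x}"] by simp
  ultimately have "dim W > 0" using V(2) by linarith
  moreover have "subspace W"
    using V(1) by (auto simp: W_def subspace_def orthogonal_clauses)
  ultimately obtain y where "y \<in> W" "norm y = 1" by (metis unit_vector_in_subspace)
  then show ?thesis using that[of y] span_base[of x "{x}"] by (auto simp: W_def orthogonal_def)
qed

text \<open>
  The planar case has the same structure as the inductive step, one dimension lower: the
  unit segments are slices of growth one, and the lines that contain them are the hyperplanes
  of a sheaf. An open set of directions around \<open>q\<close> contains the directions of
  \<open>q - s * p\<close> for all small \<open>s\<close>, and these are orthogonal to \<open>p + s * q\<close>.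
\<close>

lemma covering_growth_kakeya_set:
  fixes V K :: "'a::euclidean_space set"
  assumes V: "hyperplane 2 V" and K: "kakeya_set V K"
  shows "covering_growth 2 K"
proof -
  have sV: "subspace V" "dim V = 2" using V by (auto simp: hyperplane_def)
  obtain \<Omega> a where O: "\<Omega> \<subseteq> unit_sphere V" "top_of_set (unit_sphere V) interior_of \<Omega> \<noteq> {}"
     "bounded K" "\<forall>\<theta>\<in>\<Omega>. a \<theta> \<in> V" "K = (\<Union>\<theta>\<in>\<Omega>. unit_segment (a \<theta>) \<theta>)"
    using K by (auto simp: kakeya_set_def directional_kakeya_set_def)
  obtain T q where T: "open T" "q \<in> T" "q \<in> unit_sphere V" "T \<inter> unit_sphere V \<subseteq> \<Omega>"
    using O(2) by (auto simp: interior_of_def openin_open Int_commute)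
  have q: "q \<in> V" "norm q = 1" using T by (auto simp: unit_sphere_def)
  obtain p where p: "p \<in> V" "norm p = 1" "q \<bullet> p = 0"
    using unit_vector_orthogonal_in_subspace[OF sV(1) _ q] sV(2) by force
  define w where "w = (\<lambda>s. q - s *\<^sub>R p)"
  define \<theta> where "\<theta> = (\<lambda>s. w s /\<^sub>R norm (w s))"
  have w0: "w s \<noteq> 0" for s
  proof -
    have "w s \<bullet> q = 1" using q p by (simp add: w_def inner_diff_left norm_eq_1 inner_add_right inner_diff_right inner_commute)
    then show ?thesis by auto
  qed
  have \<theta>: "norm (\<theta> s) = 1" "\<theta> s \<in> V" for s
    using w0 q p sV(1) by (auto simp: \<theta>_def w_def intro!: subspace_scale subspace_diff)
  have "continuous_on UNIV w" unfolding w_def by (intro continuous_intros)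
  then have "continuous_on UNIV \<theta>" unfolding \<theta>_def using w0 by (intro continuous_intros) auto
  then have "open (\<theta> -` T)" using T(1) by (rule open_vimage[rotated])
  moreover have "0 \<in> \<theta> -` T" using T q by (simp add: \<theta>_def w_def)
  ultimately obtain r where r: "r > 0" "ball 0 r \<subseteq> \<theta> -` T" by (meson openE)
  have "covering_growth (real (1 + 1)) K"
  proof (rule covering_growth_sheaf[OF sV(1) _ p(1) q(1) p(2) q(2)])
    show "- r < r" using r by simp
    fix s assume "s \<in> {-r<..<r}"
    then have "\<theta> s \<in> T" using r by (auto simp: ball_eq_greaterThanLessThan)
    then have O': "\<theta> s \<in> \<Omega>" using T \<theta> by (auto simp: unit_sphere_def)
    define S where "S = unit_segment (a (\<theta> s)) (\<theta> s)"
    have orth: "\<theta> s \<bullet> p + s * (\<theta> s \<bullet> q) = 0"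
    proof -
      have "w s \<bullet> p + s * (w s \<bullet> q) = 0"
        using p q by (simp add: w_def inner_diff_left norm_eq_1 inner_add_right inner_diff_right inner_commute)
      then have "inverse (norm (w s)) * (w s \<bullet> p + s * (w s \<bullet> q)) = 0" by simp
      then show ?thesis by (simp add: \<theta>_def algebra_simps)
    qed
    have pt: "x \<in> V" "x \<bullet> p + s * (x \<bullet> q) = a (\<theta> s) \<bullet> p + s * (a (\<theta> s) \<bullet> q)" if xS: "x \<in> S" for x
    proof -
      obtain u where "x = (1 - u) *\<^sub>R (a (\<theta> s) - (1/2) *\<^sub>R \<theta> s) + u *\<^sub>R (a (\<theta> s) + (1/2) *\<^sub>R \<theta> s)"
        using xS by (auto simp: S_def unit_segment_def closed_segment_def)
      moreover have "(1 - u) *\<^sub>R (c - h *\<^sub>R t) + u *\<^sub>R (c + h *\<^sub>R t) = c + (u * h - (1 - u) * h) *\<^sub>R t"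
        for c t :: 'a and h
        by (simp add: algebra_simps, simp flip: scaleR_add_left)
      moreover have "u * (1/2) - (1 - u) * (1/2) = u - 1/2" by (simp add: field_simps)
      ultimately have x: "x = a (\<theta> s) + (u - 1/2) *\<^sub>R \<theta> s" by presburger
      show "x \<in> V" unfolding x using O(4) O' \<theta> sV(1) by (auto intro!: subspace_add subspace_scale)
      have "x \<bullet> p + s * (x \<bullet> q)
          = a (\<theta> s) \<bullet> p + s * (a (\<theta> s) \<bullet> q) + (u - 1/2) * (\<theta> s \<bullet> p + s * (\<theta> s \<bullet> q))"
        by (simp add: x inner_add_left algebra_simps)
      then show "x \<bullet> p + s * (x \<bullet> q) = a (\<theta> s) \<bullet> p + s * (a (\<theta> s) \<bullet> q)" using orth by simp
    qed
    have "S \<subseteq> K" unfolding S_def O(5) using O' by blast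
    moreover have "covering_growth (real 1) S"
      unfolding S_def using covering_growth_unit_segment[OF \<theta>(1)] by simp
    ultimately show "\<exists>S c. S \<subseteq> K \<inter> V \<and> covering_growth (real 1) S \<and> (\<forall>x\<in>S. x \<bullet> p + s * (x \<bullet> q) = c)"
      using pt by blast
  qed (use sV p q O(3) in \<open>auto simp: inner_commute\<close>)
  then show ?thesis by simp
qed

text \<open>
  With \<open>p\<close>, \<open>q\<close> an orthonormal basis of the plane that defines the pages, each
  \<open>p + s * q\<close> is normal to a page, and the book in that page is a slice. The
  slices have growth \<open>k\<close> by the induction hypothesis, but at scales that depend on the page;
  \<open>covering_growth_sheaf\<close> asks for nothing more.
\<close>

lemma covering_growth_kakeya_book:
  fixes V K :: "'a::euclidean_space set"
  assumes "kakeya_book k V K"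
  shows "covering_growth (real k) K"
  using assms
proof (induction rule: kakeya_book.induct)
  case (base V K)
  then show ?case using covering_growth_kakeya_set by fastforce
next
  case (step k V K P C)
  have V: "subspace V" "dim V = k + 1" using step by (auto simp: hyperplane_def)
  have P: "subspace P" "dim P = 2" using step by (auto simp: hyperplane_def)
  obtain p where p: "p \<in> P" "norm p = 1" using unit_vector_in_subspace[OF P(1)] P(2) by force
  obtain q where q: "q \<in> P" "norm q = 1" "p \<bullet> q = 0"
    using unit_vector_orthogonal_in_subspace[OF P(1) _ p] P(2) by force
  have pqV: "p \<in> V" "q \<in> V" using p q step by auto
  show ?case
  proof (rule covering_growth_sheaf[OF V pqV p(2) q(2,3)])
    show "bounded K" by fact
    show "(0::real) < 1" by simp
    fix s :: real
    define w where "w = p + s *\<^sub>R q"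
    have "w \<bullet> p = 1" using p q by (simp add: w_def inner_add_left norm_eq_1 inner_add_right inner_diff_right inner_commute)
    then have w0: "w \<noteq> 0" by auto
    define v where "v = w /\<^sub>R norm w"
    have "v \<in> unit_sphere P"
      using w0 p q P(1) by (auto simp: v_def w_def unit_sphere_def intro!: subspace_scale subspace_add)
    then have page_v: "{x \<in> V. orthogonal v x} \<in> pages V P" by (auto simp: pages_def)
    obtain a B where aB: "a \<in> V" "kakeya_book k {x \<in> V. orthogonal v x} B"
        "covering_growth (real k) B"
        "(+) a ` B \<subseteq> K \<inter> (+) a ` {x \<in> V. orthogonal v x}"
      using bspec[OF step.IH page_v] by (elim bexE exE conjE) (assumption | rule that)+
    have BK: "(+) a ` B \<subseteq> K" using aB(4) by (rule order_trans) simp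
    have BH: "y \<in> V" "orthogonal v y" if "y \<in> B" for y
      using aB(4) that by auto
    have page: "x \<bullet> p + s * (x \<bullet> q) = a \<bullet> p + s * (a \<bullet> q)" if x: "x \<in> (+) a ` B" for x
    proof -
      obtain y where y: "x = a + y" "y \<in> B" using x by blast
      have "y \<bullet> w = 0" using BH(2)[OF y(2)] w0 by (simp add: v_def orthogonal_def inner_commute)
      then have "y \<bullet> p + s * (y \<bullet> q) = 0" by (simp add: w_def inner_add_right)
      then show ?thesis by (simp add: y(1) inner_add_left algebra_simps)
    qed
    have "bounded ((+) (- a) ` ((+) a ` B))"
      using bounded_translation bounded_subset[OF \<open>bounded K\<close> BK] by blast
    then have "bounded B" by (simp add: image_image)
    then have "covering_growth (real k) ((+) a ` B)" using aB(3) covering_growth_translation by blast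
    moreover have "(+) a ` B \<subseteq> K \<inter> V" using BK \<open>K \<subseteq> V\<close> by (simp add: order_trans)
    ultimately show "\<exists>S c. S \<subseteq> K \<inter> V \<and> covering_growth (real k) S \<and> (\<forall>x\<in>S. x \<bullet> p + s * (x \<bullet> q) = c)"
      using page by blast
  qed
qed

section \<open>Box dimension\<close>

lemma lower_box_dim_ge:
  assumes "covering_growth d K"
  shows "ereal d \<le> lower_box_dim K"
proof (rule ereal_le_epsilon2)
  fix \<epsilon> :: real assume \<epsilon>: "0 < \<epsilon>"
  then have "\<forall>\<^sub>F \<delta> in at_right 0. \<delta> powr (\<epsilon> - d) \<le> real (covering_number K \<delta>)"
    using assms by (simp add: covering_growth_def)
  moreover have "\<forall>\<^sub>F \<delta> in at_right (0::real). \<delta> < 1"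
    by (intro eventually_at_rightI[where b = 1]) auto
  ultimately have "\<forall>\<^sub>F \<delta> in at_right 0. ereal (d - \<epsilon>) \<le> ereal (ln (real (covering_number K \<delta>)) / - ln \<delta>)"
    using eventually_at_right_less[of "0::real"]
  proof eventually_elim
    case (elim \<delta>)
    have "ln \<delta> < 0" using elim by simp
    have "0 < \<delta> powr (\<epsilon> - d)" using elim by simp
    then have "ln (\<delta> powr (\<epsilon> - d)) \<le> ln (real (covering_number K \<delta>))" using elim by (intro ln_mono) auto
    then have "(d - \<epsilon>) * - ln \<delta> \<le> ln (real (covering_number K \<delta>))"
      using elim by (simp add: ln_powr algebra_simps)
    then have "d - \<epsilon> \<le> ln (real (covering_number K \<delta>)) / - ln \<delta>"
      using \<open>ln \<delta> < 0\<close> by (subst pos_le_divide_eq) auto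
    then show ?case by simp
  qed
  then have "ereal (d - \<epsilon>) \<le> lower_box_dim K" unfolding lower_box_dim_def by (rule Liminf_bounded)
  then show "ereal d \<le> lower_box_dim K + ereal \<epsilon>"
    by (cases "lower_box_dim K") auto
qed

lemma upper_box_dim_le:
  fixes K :: "'a::euclidean_space set"
  assumes "bounded K"
  shows "upper_box_dim K \<le> ereal (real DIM('a))"
proof -
  define n where "n = real DIM('a)"
  have n: "n > 0" by (simp add: n_def)
  obtain C where C: "\<And>x. x \<in> K \<Longrightarrow> norm x \<le> C" "C > 0" using assms by (meson bounded_pos)
  \<comment> \<open>The number of cubes of side \<open>\<delta> / n\<close> in a box of side \<open>2 * C\<close>, up to rounding, on the logarithmic scale.\<close>
  define g where "g = (\<lambda>\<delta>::real. n * ln (2 * (C * n / \<delta> + 1) + 1) / - ln \<delta>)"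
  have "\<forall>\<^sub>F \<delta> in at_right (0::real). \<delta> < 1"
    by (intro eventually_at_rightI[where b = 1]) auto
  then have "\<forall>\<^sub>F \<delta> in at_right 0. ereal (ln (real (covering_number K \<delta>)) / - ln \<delta>) \<le> ereal (g \<delta>)"
    using eventually_at_right_less[of "0::real"]
  proof eventually_elim
    case (elim \<delta>)
    define G where "G = 2 * (C * n / \<delta> + 1) + 1"
    have G: "G \<ge> 1" using C n elim by (simp add: G_def)
    define \<delta>' where "\<delta>' = \<delta> / n"
    have \<delta>': "\<delta>' > 0" "n * \<delta>' = \<delta>" using elim n by (auto simp: \<delta>'_def)
    have fin: "finite (cell Basis \<delta>' ` K)" "real (card (cell Basis \<delta>' ` K)) \<le> (2 * (C / \<delta>' + 1) + 1) ^ card (Basis :: 'a set)"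
      using finite_cells[of "Basis :: 'a set" \<delta>' K C] C \<delta>' by auto
    have "covering_number K (real (card (Basis :: 'a set)) * \<delta>') \<le> card (cell Basis \<delta>' ` K)"
      using fin(1) \<delta>' by (intro covering_number_le_card_cells)
        (auto simp: pairwise_def orthogonal_def inner_not_same_Basis)
    then have "real (covering_number K \<delta>) \<le> (2 * (C / \<delta>' + 1) + 1) ^ DIM('a)"
      using fin(2) \<delta>'(2) by (simp add: n_def)
    also have "2 * (C / \<delta>' + 1) + 1 = G" by (simp add: \<delta>'_def G_def)
    finally have N: "real (covering_number K \<delta>) \<le> G ^ DIM('a)" .
    have "ln (real (covering_number K \<delta>)) \<le> ln (G ^ DIM('a))"
    proof (cases "covering_number K \<delta> = 0")
      case True
      then show ?thesis using G by simp
    next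
      case False
      then show ?thesis using N by (intro ln_mono) auto
    qed
    also have "\<dots> = n * ln G" using G by (simp add: ln_realpow n_def)
    finally have "ln (real (covering_number K \<delta>)) / - ln \<delta> \<le> n * ln G / - ln \<delta>"
      using elim by (intro divide_right_mono) auto
    then show ?case by (simp only: g_def G_def ereal_less_eq)
  qed
  then have "upper_box_dim K \<le> Limsup (at_right 0) (\<lambda>\<delta>. ereal (g \<delta>))"
    unfolding upper_box_dim_def by (rule Limsup_mono)
  also have "(g \<longlongrightarrow> n) (at_right 0)" unfolding g_def using C n by real_asymp
  then have "Limsup (at_right 0) (\<lambda>\<delta>. ereal (g \<delta>)) = ereal n"
    by (intro lim_imp_Limsup) (auto intro: tendsto_intros)
  finally show ?thesis by (simp add: n_def)
qed

lemma kakeya_book_bounded: "kakeya_book k V K \<Longrightarrow> bounded K"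
  by (auto elim: kakeya_book.cases)

theorem theorem1p5:
  fixes K :: "(real ^ 'n) set"
  assumes "CARD('n) \<ge> 2"
    and "kakeya_book CARD('n) UNIV K"
  shows "has_box_dim K (real CARD('n))"
proof -
  have "ereal (real CARD('n)) \<le> lower_box_dim K"
    using covering_growth_kakeya_book[OF assms(2)] by (rule lower_box_dim_ge)
  moreover have "upper_box_dim K \<le> ereal (real CARD('n))"
    using upper_box_dim_le[OF kakeya_book_bounded[OF assms(2)]] by simp
  moreover have "lower_box_dim K \<le> upper_box_dim K"
    unfolding lower_box_dim_def upper_box_dim_def by (intro Liminf_le_Limsup) simp
  ultimately show ?thesis unfolding has_box_dim_def by (simp add: order_antisym)
qed

end
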